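(* Let $\alpha\in(0,1)$ and $K\ge1$, and let $\mathcal Y\subseteq\mathbb R$. Suppose that $\tilde Z_1,\dots,\tilde Z_{K+1}\in\tilde{\mathcal Z}$ satisfies hierarchical exchangeability, and let $Z_{\mathrm{test}}=(X_{\mathrm{test}},Y_{\mathrm{test}})=\tilde Z_{K+1,1}$ (the first entry of $\tilde Z_{K+1}$). Given a hierarchically symmetric algorithm $\mathcal A$, the hierarchical jackknife+ prediction set \begin{multline*} \widehat C(X_{\mathrm{test}})=\Big[\,Q'_\alpha\Big(\sum_{k=1}^K\sum_{i=1}^{N_k}\frac1{(K+1)N_k}\,\delta_{\widehat\mu_{-k}(X_{\mathrm{test}})-R_{k,i}}+\frac1{K+1}\,\delta_{-\infty}\Big),\\ Q_{1-\alpha}\Big(\sum_{k=1}^K\sum_{i=1}^{N_k}\frac1{(K+1)N_k}\,\delta_{\widehat\mu_{-k}(X_{\mathrm{test}})+R_{k,i}}+\frac1{K+1}\,\delta_{+\infty}\Big)\Big] \end{multline*} satisfies $$\mathbb P\{Y_{\mathrm{test}}\in\widehat C(X_{\mathrm{test}})\}\ge1-2\alpha.$$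
   Context: Data. $\mathcal Z=\mathcal X\times\mathcal Y$ is a measurable space (features times responses), and $\tilde{\mathcal Z}=\mathcal Z\cup\mathcal Z^2\cup\mathcal Z^3\cup\cdots$ is the set of all nonempty finite sequences in $\mathcal Z$; $\mathrm{length}(\tilde z)$ is the length of $\tilde z\in\tilde{\mathcal Z}$. Write $\tilde Z_k=(Z_{k,1},\dots,Z_{k,N_k})$ with $N_k=\mathrm{length}(\tilde Z_k)$ (random) and $Z_{k,i}=(X_{k,i},Y_{k,i})$. Hierarchical exchangeability. Random elements $\tilde Z_1,\dots,\tilde Z_{K+1}$ of $\tilde{\mathcal Z}$ satisfy hierarchical exchangeability if (i) $(\tilde Z_1,\dots,\tilde Z_{K+1})$ has the same distribution as $(\tilde Z_{\sigma(1)},\dots,\tilde Z_{\sigma(K+1)})$ for every permutation $\sigma$ of $\{1,\dots,K+1\}$; and (ii) for every $k\in\{1,\dots,K+1\}$, every $m\ge1$ with $\mathbb P\{\mathrm{length}(\tilde Z_k)=m\}>0$, and every permutation $\sigma$ of $\{1,\dots,m\}$, conditionally on $\mathrm{length}(\tilde Z_k)=m$ the sequence $(\tilde Z_1,\dots,\tilde Z_k,\dots,\tilde Z_{K+1})$ has the same distribution as the sequence obtained by replacing $\tilde Z_k$ by $(\tilde Z_{k,\sigma(1)},\dots,\tilde Z_{k,\sigma(m)})$. Algorithm. $\mathcal A:\tilde{\mathcal Z}^{K-1}\to\{\text{functions }\mathcal X\to\mathbb R\}$ is a (measurable) regression algorithm taking $K-1$ groups as input (for $K=1$ it is just a fixed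 function). It is hierarchically symmetric if its output is unchanged both when the input groups are permuted among themselves, and when the entries within any one input group are permuted. Leave-one-group-out models and residuals. For $k=1,\dots,K$, $\widehat\mu_{-k}=\mathcal A(\tilde Z_1,\dots,\tilde Z_{k-1},\tilde Z_{k+1},\dots,\tilde Z_K)$ and $R_{k,i}=|Y_{k,i}-\widehat\mu_{-k}(X_{k,i})|$, $i=1,\dots,N_k$. Quantiles. $\delta_t$ is the point mass at $t$. For a distribution $P$ on $\mathbb R\cup\{\pm\infty\}$, $Q_{1-\alpha}(P)=\inf\{t\in\mathbb R:\mathbb P_{T\sim P}\{T\le t\}\ge1-\alpha\}$ and $Q'_\alpha(P)=\sup\{t\in\mathbb R:\mathbb P_{T\sim P}\{T\le t\}\le\alpha\}$, with $\inf\emptyset=+\infty$ and $\sup\emptyset=-\infty$. An interval $[a,b]$ with endpoints in $\mathbb R\cup\{\pm\infty\}$ means $\{y:a\le y\le b\}$ (empty if $a>b$). *)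

theory Defs
  imports "HOL-Probability.Probability" "HOL-Combinatorics.Permutations"
begin

section \<open>Data\<close>

text \<open>Nonempty finite sequences over \<open>M\<close>, as the disjoint union of the product spaces
  \<open>M\<close>, \<open>M\<^sup>2\<close>, \<open>M\<^sup>3\<close>, \ldots: \<open>listset [A\<^sub>1, \<dots>, A\<^sub>m]\<close> is the rectangle
  \<open>A\<^sub>1 \<times> \<dots> \<times> A\<^sub>m\<close>.\<close>

definition seq_space :: "'a measure \<Rightarrow> 'a list measure" where
  "seq_space M = sigma (lists (space M) - {[]}) (listset ` {As. As \<noteq> [] \<and> set As \<subseteq> sets M})"

lemma in_listset_iff: "xs \<in> listset As \<longleftrightarrow> list_all2 (\<in>) xs As"
  by (induction As arbitrary: xs) (auto simp: set_Cons_def list_all2_Cons2)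

lemma space_seq_space [simp]: "space (seq_space M) = lists (space M) - {[]}"
  and sets_seq_space: "sets (seq_space M) =
    sigma_sets (lists (space M) - {[]}) (listset ` {As. As \<noteq> [] \<and> set As \<subseteq> sets M})"
proof -
  have "xs \<in> lists (space M) - {[]}"
    if "As \<noteq> []" "set As \<subseteq> sets M" "xs \<in> listset As" for As xs
  proof -
    have *: "list_all2 (\<in>) xs As"
      using that(3) by (simp add: in_listset_iff)
    have "x \<in> space M" if x: "x \<in> set xs" for x
    proof -
      obtain i where i: "i < length xs" "x = xs ! i"
        using x by (auto simp: in_set_conv_nth)
      with * have "x \<in> As ! i" "As ! i \<in> set As"
        by (auto simp: list_all2_conv_all_nth)
      then show ?thesis
        using \<open>set As \<subseteq> sets M\<close> sets.sets_into_space[of "As ! i" M] by blast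
    qed
    moreover have "xs \<noteq> []"
      using * that(1) by auto
    ultimately show ?thesis
      by (simp add: in_lists_conv_set)
  qed
  then have "listset ` {As. As \<noteq> [] \<and> set As \<subseteq> sets M} \<subseteq> Pow (lists (space M) - {[]})"
    by blast
  then show "space (seq_space M) = lists (space M) - {[]}"
    and "sets (seq_space M) =
      sigma_sets (lists (space M) - {[]}) (listset ` {As. As \<noteq> [] \<and> set As \<subseteq> sets M})"
    by (simp_all add: seq_space_def)
qed

text \<open>\<open>\<Y>\<close> is an arbitrary set of reals with the trace of the Borel sets; \<open>\<X> \<times> \<Y>\<close> carries the
  product \<open>\<sigma>\<close>-algebra.\<close>

definition obs_space :: "'x measure \<Rightarrow> real set \<Rightarrow> ('x \<times> real) measure" where
  "obs_space MX Y = MX \<Otimes>\<^sub>M restrict_space borel Y"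

definition group_space :: "'x measure \<Rightarrow> real set \<Rightarrow> ('x \<times> real) list measure" where
  "group_space MX Y = seq_space (obs_space MX Y)"

text \<open>A tuple of groups indexed by a set \<open>I\<close> is an element of \<open>PiM I (\<lambda>_. group_space MX Y)\<close>. Groups
  are numbered from 1; positions inside a group are list positions and hence start at 0.\<close>

definition hier_exchangeable ::
    "'w measure \<Rightarrow> 'a list measure \<Rightarrow> nat \<Rightarrow> (nat \<Rightarrow> 'w \<Rightarrow> 'a list) \<Rightarrow> bool" where
  "hier_exchangeable M S n Z \<longleftrightarrow>
    (\<forall>\<pi>. \<pi> permutes {1..n} \<longrightarrow>
      distr M (PiM {1..n} (\<lambda>_. S)) (\<lambda>\<omega>. \<lambda>j\<in>{1..n}. Z j \<omega>) =
      distr M (PiM {1..n} (\<lambda>_. S)) (\<lambda>\<omega>. \<lambda>j\<in>{1..n}. Z (\<pi> j) \<omega>)) \<and>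
    (\<forall>k\<in>{1..n}. \<forall>m\<ge>1. \<forall>\<sigma>.
      \<P>(\<omega> in M. length (Z k \<omega>) = m) > 0 \<longrightarrow> \<sigma> permutes {..<m} \<longrightarrow>
      (\<forall>B\<in>sets (PiM {1..n} (\<lambda>_. S)).
        \<P>(\<omega> in M. (\<lambda>j\<in>{1..n}. Z j \<omega>) \<in> B \<bar> length (Z k \<omega>) = m) =
        \<P>(\<omega> in M. (\<lambda>j\<in>{1..n}. if j = k then permute_list \<sigma> (Z j \<omega>) else Z j \<omega>) \<in> B
            \<bar> length (Z k \<omega>) = m)))"

section \<open>Algorithm, leave-one-group-out models and residuals\<close>

definition measurable_algorithm ::
    "'x measure \<Rightarrow> ('x \<times> real) list measure \<Rightarrow> nat \<Rightarrow>
     ((nat \<Rightarrow> ('x \<times> real) list) \<Rightarrow> 'x \<Rightarrow> real) \<Rightarrow> bool" where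
  "measurable_algorithm MX S n \<A> \<longleftrightarrow>
    (\<lambda>(D, x). \<A> D x) \<in> borel_measurable (PiM {1..n} (\<lambda>_. S) \<Otimes>\<^sub>M MX)"

definition hier_symmetric ::
    "'x measure \<Rightarrow> ('x \<times> real) list measure \<Rightarrow> nat \<Rightarrow>
     ((nat \<Rightarrow> ('x \<times> real) list) \<Rightarrow> 'x \<Rightarrow> real) \<Rightarrow> bool" where
  "hier_symmetric MX S n \<A> \<longleftrightarrow>
    (\<forall>D\<in>space (PiM {1..n} (\<lambda>_. S)). \<forall>x\<in>space MX.
      (\<forall>\<pi>. \<pi> permutes {1..n} \<longrightarrow> \<A> (\<lambda>j\<in>{1..n}. D (\<pi> j)) x = \<A> D x) \<and>
      (\<forall>j\<in>{1..n}. \<forall>\<sigma>. \<sigma> permutes {..<length (D j)} \<longrightarrow>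
        \<A> (D(j := permute_list \<sigma> (D j))) x = \<A> D x))"

definition logo_model ::
    "((nat \<Rightarrow> ('x \<times> real) list) \<Rightarrow> 'x \<Rightarrow> real) \<Rightarrow> nat \<Rightarrow> (nat \<Rightarrow> ('x \<times> real) list) \<Rightarrow> nat \<Rightarrow>
     'x \<Rightarrow> real" where
  "logo_model \<A> K D k = \<A> (\<lambda>j\<in>{1..K - 1}. if j < k then D j else D (j + 1))"

definition logo_residual ::
    "((nat \<Rightarrow> ('x \<times> real) list) \<Rightarrow> 'x \<Rightarrow> real) \<Rightarrow> nat \<Rightarrow> (nat \<Rightarrow> ('x \<times> real) list) \<Rightarrow> nat \<Rightarrow>
     nat \<Rightarrow> real" where
  "logo_residual \<A> K D k i = \<bar>snd (D k ! i) - logo_model \<A> K D k (fst (D k ! i))\<bar>"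

section \<open>Quantiles and the prediction set\<close>

text \<open>The infimum and supremum are over real \<open>t\<close> but taken in the extended reals, so that
  \<open>Inf {} = \<infinity>\<close> and \<open>Sup {} = -\<infinity>\<close>.\<close>

definition quantile :: "real \<Rightarrow> ereal measure \<Rightarrow> ereal" where
  "quantile \<beta> P = Inf (ereal ` {t. measure P {..ereal t} \<ge> \<beta>})"

definition quantile' :: "real \<Rightarrow> ereal measure \<Rightarrow> ereal" where
  "quantile' \<beta> P = Sup (ereal ` {t. measure P {..ereal t} \<le> \<beta>})"

text \<open>\<open>group_mixture K N c e\<close> is the distribution
  \<open>\<Sum>\<^sub>k \<Sum>\<^sub>i 1 / ((K + 1) N\<^sub>k) \<delta>\<^bsub>c k i\<^esub> + 1 / (K + 1) \<delta>\<^sub>e\<close>; the point mass at \<open>t\<close> is \<open>return borel t\<close>.\<close>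

definition group_mixture ::
    "nat \<Rightarrow> (nat \<Rightarrow> nat) \<Rightarrow> (nat \<Rightarrow> nat \<Rightarrow> real) \<Rightarrow> ereal \<Rightarrow> ereal measure" where
  "group_mixture K N c e = measure_of UNIV (sets borel) (\<lambda>S.
     (\<Sum>k=1..K. \<Sum>i<N k. ennreal (1 / (real (K + 1) * real (N k))) *
        emeasure (return borel (ereal (c k i))) S) +
     ennreal (1 / real (K + 1)) * emeasure (return borel e) S)"

definition hier_jackknife_plus ::
    "((nat \<Rightarrow> ('x \<times> real) list) \<Rightarrow> 'x \<Rightarrow> real) \<Rightarrow> nat \<Rightarrow> real \<Rightarrow> (nat \<Rightarrow> ('x \<times> real) list) \<Rightarrow>
     'x \<Rightarrow> real set" where
  "hier_jackknife_plus \<A> K \<alpha> D x = {y.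
     quantile' \<alpha> (group_mixture K (\<lambda>k. length (D k))
       (\<lambda>k i. logo_model \<A> K D k x - logo_residual \<A> K D k i) (-\<infinity>)) \<le> ereal y \<and>
     ereal y \<le> quantile (1 - \<alpha>) (group_mixture K (\<lambda>k. length (D k))
       (\<lambda>k i. logo_model \<A> K D k x + logo_residual \<A> K D k i) \<infinity>)}"

text \<open>The set function given to \<open>measure_of\<close> is indeed a measure, of total mass 1.\<close>

lemma space_group_mixture [simp]: "space (group_mixture K N c e) = UNIV"
  and sets_group_mixture [simp]: "sets (group_mixture K N c e) = sets borel"
  using sets.sigma_sets_eq[of "borel :: ereal measure"] sets.space_closed[of "borel :: ereal measure"]
  by (simp_all add: group_mixture_def)

lemma emeasure_group_mixture:
  assumes "S \<in> sets borel"
  shows "emeasure (group_mixture K N c e) S =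
     (\<Sum>k=1..K. \<Sum>i<N k. ennreal (1 / (real (K + 1) * real (N k))) *
        emeasure (return borel (ereal (c k i))) S) +
     ennreal (1 / real (K + 1)) * emeasure (return borel e) S"
    (is "_ = ?f S")
proof (rule emeasure_measure_of[OF group_mixture_def])
  show "positive (sets (group_mixture K N c e)) ?f"
    by (simp add: positive_def)
  show "countably_additive (sets (group_mixture K N c e)) ?f"
  proof (rule countably_additiveI)
    fix A :: "nat \<Rightarrow> ereal set"
    assume A: "range A \<subseteq> sets (group_mixture K N c e)" "disjoint_family A"
    have *: "(\<Sum>n. emeasure (return borel a) (A n)) = emeasure (return borel a) (\<Union>n. A n)"
      for a :: ereal
      using A by (intro suminf_emeasure) auto
    show "(\<Sum>n. ?f (A n)) = ?f (\<Union>n. A n)"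
      by (simp add: suminf_add[symmetric] suminf_sum * del: emeasure_return)
  qed
qed (use assms in auto)

lemma prob_space_group_mixture:
  assumes "\<And>k. k \<in> {1..K} \<Longrightarrow> N k > 0"
  shows "prob_space (group_mixture K N c e)"
proof
  have "(\<Sum>k=1..K. \<Sum>i<N k. ennreal (1 / (real (K + 1) * real (N k)))) =
      (\<Sum>k=1..K. ennreal (1 / real (K + 1)))"
    using assms by (intro sum.cong refl) (simp add: ennreal_of_nat_eq_real_of_nat flip: ennreal_mult)
  moreover have "(\<Sum>k=1..K. ennreal (1 / real (K + 1))) + ennreal (1 / real (K + 1)) = 1"
    by (simp add: ennreal_of_nat_eq_real_of_nat flip: ennreal_mult ennreal_plus)
       (simp add: field_simps)
  ultimately show "emeasure (group_mixture K N c e) (space (group_mixture K N c e)) = 1"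
    by (simp add: emeasure_group_mixture)
qed

end

theory Submission
  imports Defs
begin

text \<open>Call an entry of one of the \<open>K + 1\<close> groups strange if it has the larger residual in
  comparison with entries of the other groups of total weight at least \<open>1 - \<alpha>\<close>, an entry of
  group \<open>l\<close> having weight \<open>1 / ((K + 1) N\<^sub>l)\<close>. In comparing entries of groups \<open>k\<close> and \<open>l\<close>, both
  residuals are computed from the model trained on the other \<open>K - 1\<close> groups. The coverage bound
  combines three observations.

  A test response outside the prediction set makes the test point strange
  (\<open>strange_if_not_covered\<close>): when one of the two is the test group, the model just described
  is one of the leave-one-group-out models, and a response beyond the upper or lower quantile lies
  beyond atoms \<open>\<mu> \<plusminus> R\<close> of weight at least \<open>1 - \<alpha>\<close>, thus has a residual exceeding the corresponding
  \<open>R\<close>. The extra atom at \<open>\<plusminus>\<infinity>\<close>, of weight \<open>1 / (K + 1)\<close>, stands for the test group itself, which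
  contributes no opponents.

  For every outcome the strange entries have total weight at most \<open>2 \<alpha>\<close>
  (\<open>group_mass_strange_le\<close>). This is a deterministic statement on weighted tournaments
  (\<open>tournament_bound\<close>), proved by double counting.

  Finally, the test point is strange with a probability equal to the expected total weight of
  the strange entries. By exchangeability of the groups all groups contribute the same
  (\<open>expected_strange_mass_eq\<close>), which needs the algorithm to be symmetric in its input groups; by
  exchangeability inside the test group, conditional on its length, its first entry is as likely
  to be strange as any other (\<open>prob_strange_entry_eq\<close>).

  A large part of the work is measurability: the entries of a group of random length, and the
  event of coverage itself, which is defined by an infimum and a supremum over all real \<open>t\<close>, must
  be seen to be measurable.\<close>

section \<open>Weighted tournaments\<close>

text \<open>The beats inside the set of winners, of weight \<open>W\<close>, carry at most \<open>W\<^sup>2 / 2\<close> of the product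
  weight, because of two opposite pairs at most one is a beat; the beats against the rest
  carry at most \<open>W (1 - W)\<close>. Since every winner beats opponents of weight \<open>1 - \<alpha>\<close>, this gives
  \<open>(1 - \<alpha>) W \<le> W - W\<^sup>2 / 2\<close>, hence \<open>W \<le> 2 \<alpha>\<close>. This double counting is where the factor 2 in
  the coverage guarantee arises.\<close>
lemma tournament_bound:
  fixes w :: "'i \<Rightarrow> real"
  assumes fin: "finite I" and w: "\<And>p. p \<in> I \<Longrightarrow> 0 \<le> w p" and total: "sum w I \<le> 1"
    and \<alpha>: "0 \<le> \<alpha>"
    and asym: "\<And>p q. p \<in> I \<Longrightarrow> q \<in> I \<Longrightarrow> beats p q \<Longrightarrow> \<not> beats q p"
  shows "(\<Sum>p\<in>I. w p * of_bool (1 - \<alpha> \<le> (\<Sum>q\<in>I. w q * of_bool (beats p q)))) \<le> 2 * \<alpha>"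
proof -
  define S where "S = {p \<in> I. 1 - \<alpha> \<le> (\<Sum>q\<in>I. w q * of_bool (beats p q))}"
  define W where "W = sum w S"
  define b where "b p q = w p * w q * of_bool (beats p q)" for p q
  have S: "S \<subseteq> I" "finite S"
    using fin by (auto simp: S_def)
  have W0: "0 \<le> W"
    unfolding W_def using S w by (intro sum_nonneg) auto
  have "(1 - \<alpha>) * W = (\<Sum>p\<in>S. w p * (1 - \<alpha>))"
    by (simp add: W_def sum_distrib_left mult.commute)
  also have "\<dots> \<le> (\<Sum>p\<in>S. w p * (\<Sum>q\<in>I. w q * of_bool (beats p q)))"
    using S w by (intro sum_mono mult_left_mono) (auto simp: S_def)
  also have "\<dots> = (\<Sum>p\<in>S. \<Sum>q\<in>I. b p q)"
    by (simp add: b_def sum_distrib_left mult.assoc)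
  also have "\<dots> = (\<Sum>p\<in>S. \<Sum>q\<in>S. b p q) + (\<Sum>p\<in>S. \<Sum>q\<in>I - S. b p q)"
    by (simp add: sum.subset_diff[OF S(1) fin] sum.distrib add.commute)
  finally have split: "(1 - \<alpha>) * W \<le> (\<Sum>p\<in>S. \<Sum>q\<in>S. b p q) + (\<Sum>p\<in>S. \<Sum>q\<in>I - S. b p q)" .
  have "(\<Sum>p\<in>S. \<Sum>q\<in>I - S. b p q) \<le> (\<Sum>p\<in>S. \<Sum>q\<in>I - S. w p * w q)"
    using S w by (intro sum_mono) (auto simp: b_def)
  also have "\<dots> = W * sum w (I - S)"
    by (simp add: W_def sum_product)
  also have "\<dots> \<le> W * (1 - W)"
    using total W0 S fin by (intro mult_left_mono) (auto simp: W_def sum_diff)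
  finally have outer: "(\<Sum>p\<in>S. \<Sum>q\<in>I - S. b p q) \<le> W * (1 - W)" .
  have "2 * (\<Sum>p\<in>S. \<Sum>q\<in>S. b p q) = (\<Sum>p\<in>S. \<Sum>q\<in>S. b p q) + (\<Sum>p\<in>S. \<Sum>q\<in>S. b q p)"
    by (subst (3) sum.swap) simp
  also have "\<dots> = (\<Sum>p\<in>S. \<Sum>q\<in>S. b p q + b q p)"
    by (simp add: sum.distrib)
  also have "\<dots> \<le> (\<Sum>p\<in>S. \<Sum>q\<in>S. w p * w q)"
  proof (intro sum_mono)
    fix p q assume "p \<in> S" "q \<in> S"
    then show "b p q + b q p \<le> w p * w q"
      using asym[of p q] w[of p] w[of q] S by (auto simp: b_def subset_iff)
  qed
  also have "\<dots> = W * W"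
    by (simp add: W_def sum_product)
  finally have inner: "2 * (\<Sum>p\<in>S. \<Sum>q\<in>S. b p q) \<le> W * W" .
  have "W * W \<le> 2 * \<alpha> * W"
    using split outer inner by (simp add: algebra_simps)
  then have "W \<le> 2 * \<alpha>"
    using W0 \<alpha> by (cases "W = 0") auto
  also have "W = (\<Sum>p\<in>I. w p * of_bool (1 - \<alpha> \<le> (\<Sum>q\<in>I. w q * of_bool (beats p q))))"
    unfolding W_def S_def using fin by (simp add: sum.If_cases of_bool_def if_distrib Int_def cong: if_cong)
  finally show ?thesis .
qed

section \<open>Quantiles of finitely supported distributions\<close>

text \<open>The distribution function of a finite sum of point masses is a step function: among the
  finitely many atoms below \<open>y\<close> there is a largest one, and up to it the mass is already the
  whole mass below \<open>y\<close>. So the infimum over all real \<open>t\<close> reduces to one inequality on the mass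
  strictly below \<open>y\<close>.\<close>
lemma step_le_Inf_iff:
  fixes w c :: "'i \<Rightarrow> real"
  assumes fin: "finite I" and w: "\<And>p. p \<in> I \<Longrightarrow> 0 \<le> w p" and \<beta>: "0 < \<beta>"
  shows "ereal y \<le> Inf (ereal ` {t. \<beta> \<le> (\<Sum>p\<in>I. w p * of_bool (c p \<le> t))}) \<longleftrightarrow>
    \<not> \<beta> \<le> (\<Sum>p\<in>I. w p * of_bool (c p < y))"
proof
  assume le: "ereal y \<le> Inf (ereal ` {t. \<beta> \<le> (\<Sum>p\<in>I. w p * of_bool (c p \<le> t))})"
  show "\<not> \<beta> \<le> (\<Sum>p\<in>I. w p * of_bool (c p < y))"
  proof
    assume big: "\<beta> \<le> (\<Sum>p\<in>I. w p * of_bool (c p < y))"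
    \<comment> \<open>The largest atom below \<open>y\<close> serves as \<open>t\<close>; one exists since the mass below \<open>y\<close> is positive.\<close>
    define C where "C = c ` {p \<in> I. c p < y}"
    have finC: "finite C"
      using fin by (simp add: C_def)
    have "C \<noteq> {}"
    proof
      assume "C = {}"
      then have "(\<Sum>p\<in>I. w p * of_bool (c p < y)) = 0"
        by (intro sum.neutral) (auto simp: C_def)
      with big \<beta> show False by simp
    qed
    then have "Max C \<in> C"
      using finC by simp
    then have "Max C < y"
      by (auto simp: C_def)
    have "(\<Sum>p\<in>I. w p * of_bool (c p < y)) \<le> (\<Sum>p\<in>I. w p * of_bool (c p \<le> Max C))"
      using w finC by (intro sum_mono mult_left_mono) (auto simp: C_def of_bool_def)
    with big have "ereal (Max C) \<in> ereal ` {t. \<beta> \<le> (\<Sum>p\<in>I. w p * of_bool (c p \<le> t))}"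
      by auto
    then have "ereal y \<le> ereal (Max C)"
      using le by (meson Inf_lower order_trans)
    with \<open>Max C < y\<close> show False by simp
  qed
next
  assume small: "\<not> \<beta> \<le> (\<Sum>p\<in>I. w p * of_bool (c p < y))"
  show "ereal y \<le> Inf (ereal ` {t. \<beta> \<le> (\<Sum>p\<in>I. w p * of_bool (c p \<le> t))})"
  proof (rule Inf_greatest, clarsimp, rule ccontr)
    fix t assume t: "\<beta> \<le> (\<Sum>p\<in>I. w p * of_bool (c p \<le> t))" "\<not> y \<le> t"
    have "(\<Sum>p\<in>I. w p * of_bool (c p \<le> t)) \<le> (\<Sum>p\<in>I. w p * of_bool (c p < y))"
      using w t(2) by (intro sum_mono mult_left_mono) (auto simp: of_bool_def)
    with t(1) small show False by simp
  qed
qed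

text \<open>Here \<open>v\<close> is the mass of the atom at \<open>-\<infinity>\<close>: it lies below every real, so that the complement
  of \<open>{..t}\<close> contains only atoms \<open>c p\<close>.\<close>
lemma step_Sup_le_iff:
  fixes w c :: "'i \<Rightarrow> real"
  assumes fin: "finite I" and w: "\<And>p. p \<in> I \<Longrightarrow> 0 \<le> w p" and \<alpha>: "\<alpha> < 1"
    and total: "(\<Sum>p\<in>I. w p) + v = 1"
  shows "Sup (ereal ` {t. (\<Sum>p\<in>I. w p * of_bool (c p \<le> t)) + v \<le> \<alpha>}) \<le> ereal y \<longleftrightarrow>
    \<not> 1 - \<alpha> \<le> (\<Sum>p\<in>I. w p * of_bool (y < c p))"
proof -
  have compl: "(\<Sum>p\<in>I. w p * of_bool (c p \<le> t)) + v = 1 - (\<Sum>p\<in>I. w p * of_bool (t < c p))" for t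
  proof -
    have "(\<Sum>p\<in>I. w p * of_bool (c p \<le> t)) + (\<Sum>p\<in>I. w p * of_bool (t < c p)) = (\<Sum>p\<in>I. w p)"
      by (subst sum.distrib[symmetric]) (intro sum.cong refl, auto simp: of_bool_def)
    with total show ?thesis by simp
  qed
  show ?thesis unfolding compl
  proof
    assume le: "Sup (ereal ` {t. 1 - (\<Sum>p\<in>I. w p * of_bool (t < c p)) \<le> \<alpha>}) \<le> ereal y"
    show "\<not> 1 - \<alpha> \<le> (\<Sum>p\<in>I. w p * of_bool (y < c p))"
    proof
      assume big: "1 - \<alpha> \<le> (\<Sum>p\<in>I. w p * of_bool (y < c p))"
      define C where "C = c ` {p \<in> I. y < c p}"
      have finC: "finite C"
        using fin by (simp add: C_def)
      have "C \<noteq> {}"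
      proof
        assume "C = {}"
        then have "(\<Sum>p\<in>I. w p * of_bool (y < c p)) = 0"
          by (intro sum.neutral) (auto simp: C_def)
        with big \<alpha> show False by simp
      qed
      then have "Min C \<in> C"
        using finC by simp
      then have "y < Min C"
        by (auto simp: C_def)
      \<comment> \<open>No atom lies between \<open>y\<close> and \<open>t\<close>, so both have the same mass above them.\<close>
      then obtain t where t: "y < t" "t < Min C"
        using dense by blast
      have "(\<Sum>p\<in>I. w p * of_bool (y < c p)) \<le> (\<Sum>p\<in>I. w p * of_bool (t < c p))"
      proof (intro sum_mono mult_left_mono w)
        fix p assume "p \<in> I"
        then have "y < c p \<Longrightarrow> Min C \<le> c p"
          using finC by (auto simp: C_def)
        then show "of_bool (y < c p) \<le> (of_bool (t < c p) :: real)"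
          using t by (auto simp: of_bool_def)
      qed
      with big have "ereal t \<in> ereal ` {t. 1 - (\<Sum>p\<in>I. w p * of_bool (t < c p)) \<le> \<alpha>}"
        by auto
      then have "ereal t \<le> ereal y"
        using le by (meson Sup_upper order_trans)
      with t show False by simp
    qed
  next
    assume small: "\<not> 1 - \<alpha> \<le> (\<Sum>p\<in>I. w p * of_bool (y < c p))"
    show "Sup (ereal ` {t. 1 - (\<Sum>p\<in>I. w p * of_bool (t < c p)) \<le> \<alpha>}) \<le> ereal y"
    proof (rule Sup_least, clarsimp, rule ccontr)
      fix t assume t: "1 - (\<Sum>p\<in>I. w p * of_bool (t < c p)) \<le> \<alpha>" "\<not> t \<le> y"
      have "(\<Sum>p\<in>I. w p * of_bool (t < c p)) \<le> (\<Sum>p\<in>I. w p * of_bool (y < c p))"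
        using w t(2) by (intro sum_mono mult_left_mono) (auto simp: of_bool_def)
      with t(1) small show False by simp
    qed
  qed
qed

section \<open>Nonempty sequences\<close>

lemma rectangle_in_sets_seq_space:
  assumes "As \<noteq> []" "set As \<subseteq> sets M"
  shows "listset As \<in> sets (seq_space M)"
  using assms by (auto simp: sets_seq_space intro!: sigma_sets.Basic)

text \<open>The generating rectangles fix the length of a sequence. Events about the length or about one
  entry are recovered from the rectangles on the left by a countable union over the length \<open>m\<close>.\<close>
lemma listset_coordinate:
  assumes i: "i < m" and A: "A \<in> sets M"
  shows "listset ((replicate m (space M))[i := A]) =
    {xs \<in> lists (space M). length xs = m \<and> xs ! i \<in> A}"
proof (intro set_eqI iffI)
  fix xs assume "xs \<in> listset ((replicate m (space M))[i := A])"
  then have *: "length xs = m" "\<And>j. j < m \<Longrightarrow> xs ! j \<in> (if j = i then A else space M)"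
    using i by (auto simp: in_listset_iff list_all2_conv_all_nth nth_list_update)
  have "xs ! j \<in> space M" if "j < m" for j
    using *(2)[OF that] sets.sets_into_space[OF A] by (auto split: if_splits)
  then have "set xs \<subseteq> space M"
    using *(1) by (auto simp: in_set_conv_nth)
  then show "xs \<in> {xs \<in> lists (space M). length xs = m \<and> xs ! i \<in> A}"
    using * *(2)[OF i] i by (auto simp: lists_eq_set)
next
  fix xs assume "xs \<in> {xs \<in> lists (space M). length xs = m \<and> xs ! i \<in> A}"
  then show "xs \<in> listset ((replicate m (space M))[i := A])"
    using i by (auto simp: in_listset_iff list_all2_conv_all_nth nth_list_update lists_eq_set)
qed

lemma coordinate_in_sets_seq_space:
  assumes "i < m" "A \<in> sets M"
  shows "{xs \<in> space (seq_space M). length xs = m \<and> xs ! i \<in> A} \<in> sets (seq_space M)"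
proof -
  have "{xs \<in> space (seq_space M). length xs = m \<and> xs ! i \<in> A} = listset ((replicate m (space M))[i := A])"
    using assms by (auto simp: listset_coordinate)
  moreover have "set ((replicate m (space M))[i := A]) \<subseteq> sets M"
    using assms set_update_subset_insert[of "replicate m (space M)" i A] by (auto split: if_splits)
  ultimately show ?thesis
    using assms by (auto intro!: rectangle_in_sets_seq_space)
qed

lemma measurable_length_seq_space [measurable]:
  "length \<in> measurable (seq_space M) (count_space UNIV)"
proof (rule measurableI)
  fix A :: "nat set"
  have head: "0 < length xs \<and> xs ! 0 \<in> space M" if "xs \<in> space (seq_space M)" for xs
    using that by (cases xs) auto
  have "length -` A \<inter> space (seq_space M) =
      (\<Union>m\<in>A \<inter> {0<..}. {xs \<in> space (seq_space M). length xs = m \<and> xs ! 0 \<in> space M})"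
    using head by blast
  also have "\<dots> \<in> sets (seq_space M)"
    by (intro sets.countable_UN') (auto simp del: space_seq_space intro!: coordinate_in_sets_seq_space)
  finally show "length -` A \<inter> space (seq_space M) \<in> sets (seq_space M)" .
qed simp

text \<open>Reading position \<open>i\<close> of a sequence that may be too short. Positions past the end fall back to
  the first entry, so that the map is measurable on the whole space of nonempty sequences; it is
  only evaluated at positions below the length.\<close>
definition entry :: "nat \<Rightarrow> 'a list \<Rightarrow> 'a" where
  "entry i xs = xs ! (if i < length xs then i else 0)"

lemma measurable_entry [measurable]: "entry i \<in> measurable (seq_space M) M"
proof (rule measurableI)
  fix A assume A: "A \<in> sets M"
  have "entry i -` A \<inter> space (seq_space M) =
      (\<Union>m\<in>{0<..}. {xs \<in> space (seq_space M). length xs = m \<and> xs ! (if i < m then i else 0) \<in> A})"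
    by (auto simp: entry_def simp del: lists_eq_set)
  also have "\<dots> \<in> sets (seq_space M)"
    using A by (intro sets.countable_UN') (auto simp del: space_seq_space intro!: coordinate_in_sets_seq_space)
  finally show "entry i -` A \<inter> space (seq_space M) \<in> sets (seq_space M)" .
next
  fix xs assume "xs \<in> space (seq_space M)"
  then show "entry i xs \<in> space M"
    by (auto simp: entry_def in_lists_conv_set)
qed

lemma permute_list_in_seq_space:
  assumes "xs \<in> space (seq_space M)" "\<sigma> permutes {..<length xs}"
  shows "permute_list \<sigma> xs \<in> space (seq_space M)"
proof -
  have "length (permute_list \<sigma> xs) \<noteq> 0"
    using assms(1) by simp
  then have "permute_list \<sigma> xs \<noteq> []"
    by fastforce
  then show ?thesis
    using assms by (simp add: lists_eq_set)
qed

section \<open>Models that leave out two groups\<close>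

text \<open>The increasing enumeration of the group indices other than \<open>k\<close> and \<open>l\<close>: skip the smaller of
  the two, then the larger.\<close>
definition omit_two :: "nat \<Rightarrow> nat \<Rightarrow> nat \<Rightarrow> nat" where
  "omit_two k l j =
    (let i = (if j < min k l then j else j + 1) in if i < max k l then i else i + 1)"

lemma bij_betw_omit_two:
  assumes "k \<in> {1..K + 1}" "l \<in> {1..K + 1}" "k \<noteq> l"
  shows "bij_betw (omit_two k l) {1..K - 1} ({1..K + 1} - {k, l})"
proof -
  have inj: "inj_on (omit_two k l) {1..K - 1}"
    by (auto simp: inj_on_def omit_two_def Let_def split: if_splits)
  moreover have "omit_two k l ` {1..K - 1} = {1..K + 1} - {k, l}"
  proof (rule card_subset_eq)
    show "omit_two k l ` {1..K - 1} \<subseteq> {1..K + 1} - {k, l}"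
      using assms by (auto simp: omit_two_def Let_def min_def max_def)
    show "card (omit_two k l ` {1..K - 1}) = card ({1..K + 1} - {k, l})"
      using assms by (simp only: card_image[OF inj]) (simp add: card_Diff_subset)
  qed simp
  ultimately show ?thesis
    by (simp add: bij_betw_def)
qed

text \<open>The tournament compares any two of the \<open>K + 1\<close> groups, the test group included, on an equal
  footing: the entries of groups \<open>k\<close> and \<open>l\<close> are judged by one and the same model, trained on
  the remaining \<open>K - 1\<close> groups. When one of the two is the test group, this model is the
  leave-one-group-out model of the other.\<close>
definition logo2_model ::
    "((nat \<Rightarrow> ('x \<times> real) list) \<Rightarrow> 'x \<Rightarrow> real) \<Rightarrow> nat \<Rightarrow> (nat \<Rightarrow> ('x \<times> real) list) \<Rightarrow> nat \<Rightarrow> nat \<Rightarrow>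
     'x \<Rightarrow> real" where
  "logo2_model \<A> K D k l = \<A> (\<lambda>j\<in>{1..K - 1}. D (omit_two k l j))"

definition logo2_residual ::
    "((nat \<Rightarrow> ('x \<times> real) list) \<Rightarrow> 'x \<Rightarrow> real) \<Rightarrow> nat \<Rightarrow> (nat \<Rightarrow> ('x \<times> real) list) \<Rightarrow> nat \<Rightarrow> nat \<Rightarrow>
     'x \<times> real \<Rightarrow> real" where
  "logo2_residual \<A> K D k l z = \<bar>snd z - logo2_model \<A> K D k l (fst z)\<bar>"

lemma logo2_model_commute: "logo2_model \<A> K D k l = logo2_model \<A> K D l k"
  by (simp add: logo2_model_def omit_two_def min.commute max.commute)

lemma logo2_residual_commute: "logo2_residual \<A> K D k l = logo2_residual \<A> K D l k"
  by (simp add: logo2_residual_def logo2_model_commute fun_eq_iff)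

lemma logo2_model_last:
  assumes "k \<in> {1..K}"
  shows "logo2_model \<A> K D k (K + 1) = logo_model \<A> K D k"
proof -
  have "(\<lambda>j\<in>{1..K - 1}. D (omit_two k (K + 1) j)) =
      (\<lambda>j\<in>{1..K - 1}. if j < k then D j else D (j + 1))"
    using assms by (auto simp: omit_two_def Let_def min_def max_def fun_eq_iff)
  then show ?thesis
    by (simp add: logo2_model_def logo_model_def)
qed

lemma logo2_model_cong:
  assumes "k \<in> {1..K + 1}" "l \<in> {1..K + 1}" "k \<noteq> l"
    and "\<And>j. j \<in> {1..K + 1} - {k, l} \<Longrightarrow> D j = D' j"
  shows "logo2_model \<A> K D k l = logo2_model \<A> K D' k l"
proof -
  have "(\<lambda>j\<in>{1..K - 1}. D (omit_two k l j)) = (\<lambda>j\<in>{1..K - 1}. D' (omit_two k l j))"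
    using assms(4) bij_betwE[OF bij_betw_omit_two[OF assms(1-3)]] by (auto simp: fun_eq_iff)
  then show ?thesis
    by (simp add: logo2_model_def)
qed

text \<open>Two enumerations of the same set of groups differ by a permutation of the positions.\<close>
lemma hier_symmetric_reindex:
  assumes sym: "hier_symmetric MX S n \<A>"
    and e: "bij_betw e {1..n} T" and e': "bij_betw e' {1..n} T"
    and D: "\<And>j. j \<in> T \<Longrightarrow> D j \<in> space S" and x: "x \<in> space MX"
  shows "\<A> (\<lambda>j\<in>{1..n}. D (e j)) x = \<A> (\<lambda>j\<in>{1..n}. D (e' j)) x"
proof -
  define \<pi> where "\<pi> j = (if j \<in> {1..n} then inv_into {1..n} e (e' j) else j)" for j
  have "bij_betw (inv_into {1..n} e \<circ> e') {1..n} {1..n}"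
    using e e' bij_betw_inv_into bij_betw_trans by blast
  then have "bij_betw \<pi> {1..n} {1..n}"
    by (rule iffD1[OF bij_betw_cong, rotated]) (simp add: \<pi>_def)
  then have \<pi>: "\<pi> permutes {1..n}"
    by (rule bij_imp_permutes) (auto simp: \<pi>_def)
  have e\<pi>: "e (\<pi> j) = e' j" if "j \<in> {1..n}" for j
    using that e bij_betwE[OF e'] by (auto simp: \<pi>_def bij_betw_inv_into_right)
  have "(\<lambda>j\<in>{1..n}. D (e j)) \<in> space (PiM {1..n} (\<lambda>_. S))"
    using D bij_betwE[OF e] by (auto simp: space_PiM PiE_def)
  then have "\<A> (\<lambda>j\<in>{1..n}. (\<lambda>j\<in>{1..n}. D (e j)) (\<pi> j)) x = \<A> (\<lambda>j\<in>{1..n}. D (e j)) x"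
    using sym \<pi> x unfolding hier_symmetric_def by blast
  also have "(\<lambda>j\<in>{1..n}. (\<lambda>j\<in>{1..n}. D (e j)) (\<pi> j)) = (\<lambda>j\<in>{1..n}. D (e' j))"
    using e\<pi> permutes_in_image[OF \<pi>] by (auto simp: fun_eq_iff)
  finally show ?thesis
    by (rule HOL.sym)
qed

text \<open>After relabelling the groups by \<open>\<pi>\<close>, the training groups are the same, only enumerated in
  another order.\<close>
lemma logo2_model_permute:
  assumes sym: "hier_symmetric MX S (K - 1) \<A>" and \<pi>: "\<pi> permutes {1..K + 1}"
    and D: "D \<in> space (PiM {1..K + 1} (\<lambda>_. S))" and x: "x \<in> space MX"
    and kl: "k \<in> {1..K + 1}" "l \<in> {1..K + 1}" "k \<noteq> l"
  shows "logo2_model \<A> K (\<lambda>j\<in>{1..K + 1}. D (\<pi> j)) k l x = logo2_model \<A> K D (\<pi> k) (\<pi> l) x"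
proof -
  have \<pi>kl: "\<pi> k \<in> {1..K + 1}" "\<pi> l \<in> {1..K + 1}" "\<pi> k \<noteq> \<pi> l"
    using kl permutes_in_image[OF \<pi>] permutes_inj[OF \<pi>] by (auto dest: injD)
  have "\<pi> ` ({1..K + 1} - {k, l}) = {1..K + 1} - {\<pi> k, \<pi> l}"
    using permutes_image[OF \<pi>] permutes_inj[OF \<pi>] by (simp add: image_set_diff)
  then have "bij_betw \<pi> ({1..K + 1} - {k, l}) ({1..K + 1} - {\<pi> k, \<pi> l})"
    using permutes_inj_on[OF \<pi>] by (simp add: bij_betw_def)
  then have bij: "bij_betw (\<pi> \<circ> omit_two k l) {1..K - 1} ({1..K + 1} - {\<pi> k, \<pi> l})"
    using bij_betw_omit_two[OF kl] bij_betw_trans by blast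
  have "logo2_model \<A> K (\<lambda>j\<in>{1..K + 1}. D (\<pi> j)) k l x =
      \<A> (\<lambda>j\<in>{1..K - 1}. D ((\<pi> \<circ> omit_two k l) j)) x"
  proof -
    have "(\<lambda>j\<in>{1..K - 1}. (\<lambda>j\<in>{1..K + 1}. D (\<pi> j)) (omit_two k l j)) =
        (\<lambda>j\<in>{1..K - 1}. D ((\<pi> \<circ> omit_two k l) j))"
      using bij_betwE[OF bij_betw_omit_two[OF kl]] by (auto simp: fun_eq_iff)
    then show ?thesis
      by (simp add: logo2_model_def)
  qed
  also have "\<dots> = logo2_model \<A> K D (\<pi> k) (\<pi> l) x"
    unfolding logo2_model_def
    by (rule hier_symmetric_reindex[OF sym bij bij_betw_omit_two[OF \<pi>kl] _ x])
       (use D in \<open>auto simp: space_PiM\<close>)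
  finally show ?thesis .
qed

section \<open>Strange entries\<close>

text \<open>The weights are those of the two mixtures whose quantiles bound the prediction set, applied to
  any set \<open>L\<close> of groups. Each nonempty group has total weight \<open>1 / (K + 1)\<close>, whatever its length.\<close>
definition group_mass ::
    "nat \<Rightarrow> nat set \<Rightarrow> (nat \<Rightarrow> 'z list) \<Rightarrow> (nat \<Rightarrow> 'z \<Rightarrow> bool) \<Rightarrow> real" where
  "group_mass K L D P = (\<Sum>l\<in>L. \<Sum>j<length (D l).
     1 / (real (K + 1) * real (length (D l))) * of_bool (P l (D l ! j)))"

lemma group_mass_nonneg: "0 \<le> group_mass K L D P"
  by (simp add: group_mass_def sum_nonneg)

lemma group_mass_mono:
  assumes "\<And>l z. l \<in> L \<Longrightarrow> z \<in> set (D l) \<Longrightarrow> P l z \<Longrightarrow> P' l z"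
  shows "group_mass K L D P \<le> group_mass K L D P'"
  unfolding group_mass_def
  using assms by (intro sum_mono mult_left_mono) (auto simp: of_bool_def)

lemma group_mass_cong:
  assumes "\<And>l. l \<in> L \<Longrightarrow> D l = D' l" "\<And>l z. l \<in> L \<Longrightarrow> z \<in> set (D' l) \<Longrightarrow> P l z = P' l z"
  shows "group_mass K L D P = group_mass K L D' P'"
  unfolding group_mass_def using assms by (intro sum.cong refl) auto

lemma group_mass_all_true:
  assumes "\<And>l. l \<in> L \<Longrightarrow> D l \<noteq> []"
  shows "group_mass K L D (\<lambda>_ _. True) = real (card L) / real (K + 1)"
proof -
  have "group_mass K L D (\<lambda>_ _. True) = (\<Sum>l\<in>L. 1 / real (K + 1))"
    unfolding group_mass_def using assms by (intro sum.cong refl) simp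
  then show ?thesis by simp
qed

lemma group_mass_Sigma:
  assumes "finite L"
  shows "group_mass K L D P = (\<Sum>(l, j)\<in>Sigma L (\<lambda>l. {..<length (D l)}).
     1 / (real (K + 1) * real (length (D l))) * of_bool (P l (D l ! j)))"
  unfolding group_mass_def using assms by (intro sum.Sigma) auto

text \<open>The condition compares a data point \<open>z\<close>, taken to belong to group \<open>k\<close>, with every entry of every
  other group \<open>l\<close>, both residuals being computed from the model without groups \<open>k\<close> and \<open>l\<close>.
  The point is strange if it has the larger residual against opponents of weight at least
  \<open>1 - \<alpha>\<close>. The point \<open>z\<close> is a separate argument, rather than a position inside group \<open>k\<close>, because the
  condition does not otherwise look at the data of group \<open>k\<close>.\<close>
definition strange ::
    "((nat \<Rightarrow> ('x \<times> real) list) \<Rightarrow> 'x \<Rightarrow> real) \<Rightarrow> nat \<Rightarrow> real \<Rightarrow> (nat \<Rightarrow> ('x \<times> real) list) \<Rightarrow> nat \<Rightarrow>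
     'x \<times> real \<Rightarrow> bool" where
  "strange \<A> K \<alpha> D k z \<longleftrightarrow> 1 - \<alpha> \<le> group_mass K ({1..K + 1} - {k}) D
     (\<lambda>l z'. logo2_residual \<A> K D k l z' < logo2_residual \<A> K D k l z)"

text \<open>Entries of the same group never meet, and the common model makes the comparison of two entries
  of different groups antisymmetric, so the tournament bound applies to the entries of all
  \<open>K + 1\<close> groups.\<close>
lemma group_mass_strange_le:
  assumes \<alpha>: "0 \<le> \<alpha>" and D: "\<And>k. k \<in> {1..K + 1} \<Longrightarrow> D k \<noteq> []"
  shows "group_mass K {1..K + 1} D (strange \<A> K \<alpha> D) \<le> 2 * \<alpha>"
proof -
  define I where "I = Sigma {1..K + 1} (\<lambda>l. {..<length (D l)})"
  define w where "w = (\<lambda>(l, j :: nat). 1 / (real (K + 1) * real (length (D l))))"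
  define beats where "beats = (\<lambda>(k, i) (l, j). k \<noteq> l \<and>
     logo2_residual \<A> K D k l (D l ! j) < logo2_residual \<A> K D k l (D k ! i))"
  have "strange \<A> K \<alpha> D k (D k ! i) \<longleftrightarrow>
      1 - \<alpha> \<le> (\<Sum>q\<in>I. w q * of_bool (beats (k, i) q))" if "k \<in> {1..K + 1}" for k i
  proof -
    have "(\<Sum>q\<in>I. w q * of_bool (beats (k, i) q)) = group_mass K {1..K + 1} D
       (\<lambda>l z'. k \<noteq> l \<and> logo2_residual \<A> K D k l z' < logo2_residual \<A> K D k l (D k ! i))"
      by (simp add: group_mass_Sigma I_def w_def beats_def case_prod_unfold)
    also have "\<dots> = group_mass K ({1..K + 1} - {k}) D
       (\<lambda>l z'. k \<noteq> l \<and> logo2_residual \<A> K D k l z' < logo2_residual \<A> K D k l (D k ! i))"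
      unfolding group_mass_def by (intro sum.mono_neutral_right) auto
    also have "\<dots> = group_mass K ({1..K + 1} - {k}) D
       (\<lambda>l z'. logo2_residual \<A> K D k l z' < logo2_residual \<A> K D k l (D k ! i))"
      by (intro group_mass_cong) auto
    finally show ?thesis
      by (simp add: strange_def)
  qed
  then have "group_mass K {1..K + 1} D (strange \<A> K \<alpha> D) =
      (\<Sum>p\<in>I. w p * of_bool (1 - \<alpha> \<le> (\<Sum>q\<in>I. w q * of_bool (beats p q))))"
    unfolding group_mass_Sigma[OF finite_atLeastAtMost] I_def[symmetric]
    by (intro sum.cong refl) (auto simp: I_def w_def)
  also have "\<dots> \<le> 2 * \<alpha>"
  proof (rule tournament_bound[OF _ _ _ \<alpha>])
    have "sum w I = group_mass K {1..K + 1} D (\<lambda>_ _. True)"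
      by (simp add: group_mass_Sigma I_def w_def case_prod_unfold)
    then show "sum w I \<le> 1"
      using group_mass_all_true[of "{1..K + 1}" D K] D by simp
  qed (auto simp: I_def w_def beats_def logo2_residual_commute)
  finally show ?thesis .
qed

lemma strange_permute:
  assumes sym: "hier_symmetric MX (group_space MX Y) (K - 1) \<A>" and \<pi>: "\<pi> permutes {1..K + 1}"
    and D: "D \<in> space (PiM {1..K + 1} (\<lambda>_. group_space MX Y))"
    and z: "z \<in> space (obs_space MX Y)" and k: "k \<in> {1..K + 1}"
  shows "strange \<A> K \<alpha> (\<lambda>j\<in>{1..K + 1}. D (\<pi> j)) k z = strange \<A> K \<alpha> D (\<pi> k) z"
proof -
  let ?D = "\<lambda>j\<in>{1..K + 1}. D (\<pi> j)"
  have "\<pi> ` ({1..K + 1} - {k}) = {1..K + 1} - {\<pi> k}"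
    using permutes_image[OF \<pi>] permutes_inj[OF \<pi>] by (simp add: image_set_diff)
  then have bij: "bij_betw \<pi> ({1..K + 1} - {k}) ({1..K + 1} - {\<pi> k})"
    using permutes_inj_on[OF \<pi>] by (simp add: bij_betw_def)
  have res: "logo2_residual \<A> K ?D k l z' = logo2_residual \<A> K D (\<pi> k) (\<pi> l) z'"
    if "l \<in> {1..K + 1} - {k}" "z' \<in> space (obs_space MX Y)" for l z'
    using that k logo2_model_permute[OF sym \<pi> D]
    by (auto simp: logo2_residual_def obs_space_def space_pair_measure)
  have entries: "z' \<in> space (obs_space MX Y)" if "l \<in> {1..K + 1}" "z' \<in> set (D l)" for l z'
  proof -
    have "D l \<in> space (group_space MX Y)"
      using that(1) D by (simp add: space_PiM PiE_iff)
    then show ?thesis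
      using that(2) by (auto simp: group_space_def lists_eq_set)
  qed
  have "group_mass K ({1..K + 1} - {k}) ?D
       (\<lambda>l z'. logo2_residual \<A> K ?D k l z' < logo2_residual \<A> K ?D k l z) =
     group_mass K ({1..K + 1} - {k}) (\<lambda>j. D (\<pi> j))
       (\<lambda>l z'. logo2_residual \<A> K D (\<pi> k) (\<pi> l) z' < logo2_residual \<A> K D (\<pi> k) (\<pi> l) z)"
  proof (intro group_mass_cong)
    fix l z' assume l: "l \<in> {1..K + 1} - {k}" and z': "z' \<in> set (D (\<pi> l))"
    have "z' \<in> space (obs_space MX Y)"
      using entries[of "\<pi> l"] l z' permutes_in_image[OF \<pi>] by blast
    then show "(logo2_residual \<A> K ?D k l z' < logo2_residual \<A> K ?D k l z) =
        (logo2_residual \<A> K D (\<pi> k) (\<pi> l) z' < logo2_residual \<A> K D (\<pi> k) (\<pi> l) z)"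
      using l z by (simp only: res)
  qed auto
  also have "\<dots> = group_mass K ({1..K + 1} - {\<pi> k}) D
       (\<lambda>l z'. logo2_residual \<A> K D (\<pi> k) l z' < logo2_residual \<A> K D (\<pi> k) l z)"
    unfolding group_mass_def by (rule sum.reindex_bij_betw[OF bij])
  finally show ?thesis
    by (simp add: strange_def)
qed

text \<open>Both the models and the opponents of group \<open>k\<close> avoid the data of group \<open>k\<close>; reordering
  the entries of that group therefore leaves the condition unchanged.\<close>
lemma strange_cong:
  assumes k: "k \<in> {1..K + 1}" and eq: "\<And>l. l \<in> {1..K + 1} - {k} \<Longrightarrow> D l = D' l"
  shows "strange \<A> K \<alpha> D k z = strange \<A> K \<alpha> D' k z"
proof -
  have "logo2_residual \<A> K D k l = logo2_residual \<A> K D' k l" if "l \<in> {1..K + 1} - {k}" for l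
    using logo2_model_cong[of k K l D D' \<A>] k eq that by (auto simp: logo2_residual_def fun_eq_iff)
  then show ?thesis
    unfolding strange_def using eq by (subst group_mass_cong[where D' = D']) auto
qed

section \<open>Measurability\<close>

lemma measurable_logo2_model:
  assumes \<A>: "measurable_algorithm MX S (K - 1) \<A>"
    and kl: "k \<in> {1..K + 1}" "l \<in> {1..K + 1}" "k \<noteq> l"
    and d: "d \<in> measurable N (PiM {1..K + 1} (\<lambda>_. S))" and f: "f \<in> measurable N MX"
  shows "(\<lambda>u. logo2_model \<A> K (d u) k l (f u)) \<in> borel_measurable N"
proof -
  have "(\<lambda>u. \<lambda>j\<in>{1..K - 1}. d u (omit_two k l j)) \<in> measurable N (PiM {1..K - 1} (\<lambda>_. S))"
  proof (rule measurable_restrict)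
    fix j assume "j \<in> {1..K - 1}"
    then have "omit_two k l j \<in> {1..K + 1}"
      using bij_betwE[OF bij_betw_omit_two[OF kl]] by auto
    then show "(\<lambda>u. d u (omit_two k l j)) \<in> measurable N S"
      by (rule measurable_compose[OF d measurable_component_singleton])
  qed
  then have "(\<lambda>u. ((\<lambda>j\<in>{1..K - 1}. d u (omit_two k l j)), f u)) \<in>
      measurable N (PiM {1..K - 1} (\<lambda>_. S) \<Otimes>\<^sub>M MX)"
    using f by (rule measurable_Pair)
  from measurable_compose[OF this \<A>[unfolded measurable_algorithm_def]] show ?thesis
    by (simp add: logo2_model_def)
qed

text \<open>The number of summands is random; \<open>measurable_compose_countable\<close> splits the space according to
  its countably many values.\<close>
lemma measurable_group_mass:
  assumes L: "L \<subseteq> J"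
    and d: "d \<in> measurable N (PiM J (\<lambda>_. seq_space O'))"
    and P: "\<And>l. l \<in> L \<Longrightarrow> Measurable.pred (N \<Otimes>\<^sub>M O') (\<lambda>p. P l (fst p) (snd p))"
  shows "(\<lambda>u. group_mass K L (d u) (\<lambda>l. P l u)) \<in> borel_measurable N"
  unfolding group_mass_def
proof (rule borel_measurable_sum)
  fix l assume l: "l \<in> L"
  have dl [measurable]: "(\<lambda>u. d u l) \<in> measurable N (seq_space O')"
    using l L by (intro measurable_compose[OF d measurable_component_singleton]) auto
  have [measurable]: "Measurable.pred N (\<lambda>u. P l u (entry j (d u l)))" for j
  proof -
    have "(\<lambda>u. (u, entry j (d u l))) \<in> measurable N (N \<Otimes>\<^sub>M O')"
      by measurable
    from measurable_compose[OF this P[OF l]] show ?thesis by simp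
  qed
  have "(\<lambda>u. (\<lambda>m u. \<Sum>j<m. 1 / (real (K + 1) * real m) * (if P l u (entry j (d u l)) then 1 else 0))
      (length (d u l)) u) \<in> borel_measurable N"
    by (rule measurable_compose_countable) measurable
  also have "(\<lambda>u. (\<lambda>m u. \<Sum>j<m. 1 / (real (K + 1) * real m) *
      (if P l u (entry j (d u l)) then 1 else 0)) (length (d u l)) u) =
    (\<lambda>u. \<Sum>j<length (d u l). 1 / (real (K + 1) * real (length (d u l))) * of_bool (P l u (d u l ! j)))"
    by (intro ext sum.cong refl) (simp add: entry_def)
  finally show "(\<lambda>u. \<Sum>j<length (d u l). 1 / (real (K + 1) * real (length (d u l))) *
      of_bool (P l u (d u l ! j))) \<in> borel_measurable N" .
qed

lemma measurable_logo2_residual: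
  assumes \<A>: "measurable_algorithm MX S (K - 1) \<A>"
    and kl: "k \<in> {1..K + 1}" "l \<in> {1..K + 1}" "k \<noteq> l"
    and d: "d \<in> measurable N (PiM {1..K + 1} (\<lambda>_. S))"
    and f: "f \<in> measurable N (obs_space MX Y)"
  shows "(\<lambda>u. logo2_residual \<A> K (d u) k l (f u)) \<in> borel_measurable N"
proof -
  have f': "(\<lambda>u. fst (f u)) \<in> measurable N MX"
      "(\<lambda>u. snd (f u)) \<in> measurable N (restrict_space borel Y)"
    using f by (auto simp: obs_space_def)
  then have [measurable]: "(\<lambda>u. snd (f u)) \<in> borel_measurable N"
    by (simp add: measurable_restrict_space2_iff)
  note measurable_logo2_model[OF \<A> kl d f'(1), measurable]
  show ?thesis
    unfolding logo2_residual_def by measurable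
qed

lemma measurable_strange:
  assumes \<A>: "measurable_algorithm MX (group_space MX Y) (K - 1) \<A>" and k: "k \<in> {1..K + 1}"
    and d [measurable]: "d \<in> measurable N (PiM {1..K + 1} (\<lambda>_. group_space MX Y))"
    and f [measurable]: "f \<in> measurable N (obs_space MX Y)"
  shows "Measurable.pred N (\<lambda>u. strange \<A> K \<alpha> (d u) k (f u))"
proof -
  have "(\<lambda>u. group_mass K ({1..K + 1} - {k}) (d u)
      (\<lambda>l z'. logo2_residual \<A> K (d u) k l z' < logo2_residual \<A> K (d u) k l (f u))) \<in>
    borel_measurable N"
  proof (rule measurable_group_mass[OF _ d[unfolded group_space_def]])
    fix l assume l: "l \<in> {1..K + 1} - {k}"
    then have kl: "k \<in> {1..K + 1}" "l \<in> {1..K + 1}" "k \<noteq> l"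
      using k by auto
    have [measurable]: "(\<lambda>p. logo2_residual \<A> K (d (fst p)) k l (snd p)) \<in>
        borel_measurable (N \<Otimes>\<^sub>M obs_space MX Y)"
      by (rule measurable_logo2_residual[OF \<A> kl]) measurable
    have [measurable]: "(\<lambda>p. logo2_residual \<A> K (d (fst p)) k l (f (fst p))) \<in>
        borel_measurable (N \<Otimes>\<^sub>M obs_space MX Y)"
      by (rule measurable_logo2_residual[OF \<A> kl]) measurable
    show "Measurable.pred (N \<Otimes>\<^sub>M obs_space MX Y)
        (\<lambda>p. logo2_residual \<A> K (d (fst p)) k l (snd p) < logo2_residual \<A> K (d (fst p)) k l (f (fst p)))"
      by measurable
  qed auto
  then show ?thesis
    unfolding strange_def by measurable
qed

section \<open>Points outside the prediction set are strange\<close>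

lemma measure_group_mixture_atMost:
  "measure (group_mixture K N c e) {..ereal t} =
    (\<Sum>(k, i)\<in>Sigma {1..K} (\<lambda>k. {..<N k}). 1 / (real (K + 1) * real (N k)) * of_bool (c k i \<le> t)) +
    1 / real (K + 1) * of_bool (e \<le> ereal t)"
    (is "_ = ?r")
proof (rule measure_eq_emeasure_eq_ennreal)
  have *: "ennreal a * indicator {..ereal t} b = ennreal (a * of_bool (b \<le> ereal t))" for a b
    by (simp add: indicator_def)
  have "emeasure (group_mixture K N c e) {..ereal t} =
      (\<Sum>k=1..K. \<Sum>i<N k. ennreal (1 / (real (K + 1) * real (N k)) * of_bool (c k i \<le> t))) +
      ennreal (1 / real (K + 1) * of_bool (e \<le> ereal t))"
    by (simp add: emeasure_group_mixture * del: of_nat_Suc of_nat_add)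
  also have "\<dots> = ennreal ((\<Sum>k=1..K. \<Sum>i<N k. 1 / (real (K + 1) * real (N k)) * of_bool (c k i \<le> t)) +
      1 / real (K + 1) * of_bool (e \<le> ereal t))"
    by (simp add: sum_ennreal sum_nonneg ennreal_plus del: of_nat_Suc of_nat_add)
  finally show "emeasure (group_mixture K N c e) {..ereal t} = ennreal ?r"
    by (subst sum.Sigma[symmetric]) auto
qed (auto intro!: add_nonneg_nonneg sum_nonneg)

text \<open>The quantile conditions in terms of masses strictly beyond \<open>y\<close>. Having an equivalence, and not
  only the implication that the coverage bound uses, is what makes the coverage event measurable.\<close>
lemma mem_hier_jackknife_plus_iff:
  assumes \<alpha>: "\<alpha> < 1" and D: "\<forall>k\<in>{1..K}. D k \<noteq> []"
  shows "y \<in> hier_jackknife_plus \<A> K \<alpha> D x \<longleftrightarrow>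
    \<not> 1 - \<alpha> \<le> group_mass K {1..K} D
      (\<lambda>k z. y < logo2_model \<A> K D k (K + 1) x - logo2_residual \<A> K D k (K + 1) z) \<and>
    \<not> 1 - \<alpha> \<le> group_mass K {1..K} D
      (\<lambda>k z. logo2_model \<A> K D k (K + 1) x + logo2_residual \<A> K D k (K + 1) z < y)"
proof -
  define I where "I = Sigma {1..K} (\<lambda>k. {..<length (D k)})"
  define w where "w = (\<lambda>(k, i :: nat). 1 / (real (K + 1) * real (length (D k))))"
  have fin: "finite I" and w: "\<And>p. p \<in> I \<Longrightarrow> 0 \<le> w p"
    by (auto simp: I_def w_def)
  have "sum w I = group_mass K {1..K} D (\<lambda>_ _. True)"
    by (simp add: group_mass_Sigma I_def w_def case_prod_unfold)
  also have "\<dots> = real K / real (K + 1)"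
    using group_mass_all_true[of "{1..K}" D K] D by simp
  finally have total: "sum w I + 1 / real (K + 1) = 1"
    by (simp add: field_simps)
  have mass: "(\<Sum>p\<in>I. w p * of_bool (P (fst p) (D (fst p) ! snd p))) = group_mass K {1..K} D P" for P
    by (simp add: group_mass_Sigma I_def w_def case_prod_unfold)
  have residual: "logo_residual \<A> K D k i = logo2_residual \<A> K D k (K + 1) (D k ! i)"
      "logo_model \<A> K D k = logo2_model \<A> K D k (K + 1)" if "k \<in> {1..K}" for k i
    using logo2_model_last[OF that, of \<A> D]
    by (simp_all add: logo_residual_def logo2_residual_def)
  define lo hi where
    "lo = (\<lambda>(k, i). logo2_model \<A> K D k (K + 1) x - logo2_residual \<A> K D k (K + 1) (D k ! i))"
    and "hi = (\<lambda>(k, i). logo2_model \<A> K D k (K + 1) x + logo2_residual \<A> K D k (K + 1) (D k ! i))"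
  have "quantile' \<alpha> (group_mixture K (\<lambda>k. length (D k))
      (\<lambda>k i. logo_model \<A> K D k x - logo_residual \<A> K D k i) (-\<infinity>)) =
    Sup (ereal ` {t. (\<Sum>p\<in>I. w p * of_bool (lo p \<le> t)) + 1 / real (K + 1) \<le> \<alpha>})"
    unfolding quantile'_def measure_group_mixture_atMost I_def[symmetric]
    by (intro arg_cong[where f = Sup] arg_cong[where f = "image ereal"] Collect_cong
        arg_cong2[where f = "(\<le>)"] arg_cong2[where f = "(+)"] refl sum.cong)
       (auto simp: I_def w_def lo_def residual)
  then have lower: "quantile' \<alpha> (group_mixture K (\<lambda>k. length (D k))
      (\<lambda>k i. logo_model \<A> K D k x - logo_residual \<A> K D k i) (-\<infinity>)) \<le> ereal y \<longleftrightarrow>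
    \<not> 1 - \<alpha> \<le> (\<Sum>p\<in>I. w p * of_bool (y < lo p))"
    using step_Sup_le_iff[OF fin w \<alpha> total] by simp
  have "quantile (1 - \<alpha>) (group_mixture K (\<lambda>k. length (D k))
      (\<lambda>k i. logo_model \<A> K D k x + logo_residual \<A> K D k i) \<infinity>) =
    Inf (ereal ` {t. 1 - \<alpha> \<le> (\<Sum>p\<in>I. w p * of_bool (hi p \<le> t)) + 0})"
    unfolding quantile_def measure_group_mixture_atMost I_def[symmetric]
    by (intro arg_cong[where f = Inf] arg_cong[where f = "image ereal"] Collect_cong
        arg_cong2[where f = "(\<le>)"] arg_cong2[where f = "(+)"] refl sum.cong)
       (auto simp: I_def w_def hi_def residual)
  then have upper: "ereal y \<le> quantile (1 - \<alpha>) (group_mixture K (\<lambda>k. length (D k))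
      (\<lambda>k i. logo_model \<A> K D k x + logo_residual \<A> K D k i) \<infinity>) \<longleftrightarrow>
    \<not> 1 - \<alpha> \<le> (\<Sum>p\<in>I. w p * of_bool (hi p < y))"
    using step_le_Inf_iff[OF fin w, where \<beta> = "1 - \<alpha>"] \<alpha> by simp
  show ?thesis
    unfolding hier_jackknife_plus_def mem_Collect_eq lower upper
    by (simp only: lo_def hi_def case_prod_unfold flip: mass)
qed

text \<open>If \<open>y\<close> lies beyond \<open>\<mu> \<plusminus> R\<close>, with \<open>\<mu>\<close> the model without group \<open>k\<close> evaluated at \<open>x\<close> and \<open>R\<close> the
  residual of an entry of group \<open>k\<close>, then \<open>\<bar>y - \<mu>\<bar> > R\<close>: the test point beats this entry. So a
  miss on either side already makes the test point beat opponents of weight \<open>1 - \<alpha>\<close>.\<close>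
lemma strange_if_not_covered:
  assumes \<alpha>: "\<alpha> < 1" and D: "\<forall>k\<in>{1..K}. D k \<noteq> []"
    and y: "y \<notin> hier_jackknife_plus \<A> K \<alpha> D x"
  shows "strange \<A> K \<alpha> D (K + 1) (x, y)"
proof -
  have J: "{1..K + 1} - {K + 1} = {1..K}"
    by auto
  have "group_mass K {1..K} D
      (\<lambda>k z. y < logo2_model \<A> K D k (K + 1) x - logo2_residual \<A> K D k (K + 1) z) \<le>
    group_mass K {1..K} D
      (\<lambda>k z. logo2_residual \<A> K D (K + 1) k z < logo2_residual \<A> K D (K + 1) k (x, y))"
    by (rule group_mass_mono)
       (auto simp: logo2_residual_def logo2_model_commute[of \<A> K D "Suc K"])
  moreover have "group_mass K {1..K} D
      (\<lambda>k z. logo2_model \<A> K D k (K + 1) x + logo2_residual \<A> K D k (K + 1) z < y) \<le>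
    group_mass K {1..K} D
      (\<lambda>k z. logo2_residual \<A> K D (K + 1) k z < logo2_residual \<A> K D (K + 1) k (x, y))"
    by (rule group_mass_mono)
       (auto simp: logo2_residual_def logo2_model_commute[of \<A> K D "Suc K"])
  ultimately show ?thesis
    using y unfolding mem_hier_jackknife_plus_iff[of \<alpha> K D, OF \<alpha> D] strange_def J by linarith
qed

section \<open>Exchangeability of the test point with all entries\<close>

locale hierarchical_sample = prob_space M for M :: "'w measure" +
  fixes MX :: "'x measure" and Y :: "real set" and K :: nat
    and Z :: "nat \<Rightarrow> 'w \<Rightarrow> ('x \<times> real) list"
    and \<A> :: "(nat \<Rightarrow> ('x \<times> real) list) \<Rightarrow> 'x \<Rightarrow> real"
  assumes measurable_Z: "\<And>k. k \<in> {1..K + 1} \<Longrightarrow> Z k \<in> measurable M (group_space MX Y)"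
    and exchangeable: "hier_exchangeable M (group_space MX Y) (K + 1) Z"
    and measurable_\<A>: "measurable_algorithm MX (group_space MX Y) (K - 1) \<A>"
    and symmetric_\<A>: "hier_symmetric MX (group_space MX Y) (K - 1) \<A>"
begin

abbreviation "tuples \<equiv> PiM {1..K + 1} (\<lambda>_. group_space MX Y)"

definition data :: "'w \<Rightarrow> nat \<Rightarrow> ('x \<times> real) list" where
  "data \<omega> = (\<lambda>j\<in>{1..K + 1}. Z j \<omega>)"

lemma data_eq: "j \<in> {1..K + 1} \<Longrightarrow> data \<omega> j = Z j \<omega>"
  by (simp add: data_def)

lemma measurable_data: "data \<in> measurable M tuples"
  unfolding data_def using measurable_Z by (rule measurable_restrict)

lemma Z_in_space: "k \<in> {1..K + 1} \<Longrightarrow> \<omega> \<in> space M \<Longrightarrow> Z k \<omega> \<in> space (group_space MX Y)"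
  using measurable_Z by (rule measurable_space)

lemma Z_nonempty: "k \<in> {1..K + 1} \<Longrightarrow> \<omega> \<in> space M \<Longrightarrow> Z k \<omega> \<noteq> []"
  using Z_in_space by (auto simp: group_space_def)

lemma measurable_length_Z: "k \<in> {1..K + 1} \<Longrightarrow> (\<lambda>\<omega>. length (Z k \<omega>)) \<in> measurable M (count_space UNIV)"
  using measurable_Z measurable_length_seq_space unfolding group_space_def by (rule measurable_compose)

lemma measurable_entry_Z: "k \<in> {1..K + 1} \<Longrightarrow> (\<lambda>\<omega>. entry i (Z k \<omega>)) \<in> measurable M (obs_space MX Y)"
  using measurable_Z measurable_entry unfolding group_space_def by (rule measurable_compose)

lemma measurable_strange_mass:
  assumes "k \<in> {1..K + 1}"
  shows "(\<lambda>D. group_mass K {k} D (strange \<A> K \<alpha> D)) \<in> borel_measurable tuples"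
proof (rule measurable_group_mass[where d = "\<lambda>D. D" and J = "{1..K + 1}"])
  fix l assume "l \<in> {k}"
  with assms have l: "l \<in> {1..K + 1}" by simp
  show "Measurable.pred (tuples \<Otimes>\<^sub>M obs_space MX Y) (\<lambda>p. strange \<A> K \<alpha> (fst p) l (snd p))"
    by (rule measurable_strange[OF measurable_\<A> l]) measurable
qed (use assms in \<open>auto simp: group_space_def\<close>)

text \<open>Exchanging group \<open>k\<close> with the test group preserves the joint law of the data, and strangeness
  follows the relabelling. Hence all groups have the same expected share of strange entries.\<close>
lemma expected_strange_mass_eq:
  assumes k: "k \<in> {1..K + 1}"
  shows "(\<integral>\<^sup>+\<omega>. ennreal (group_mass K {k} (data \<omega>) (strange \<A> K \<alpha> (data \<omega>))) \<partial>M) =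
    (\<integral>\<^sup>+\<omega>. ennreal (group_mass K {K + 1} (data \<omega>) (strange \<A> K \<alpha> (data \<omega>))) \<partial>M)"
proof -
  define \<pi> where "\<pi> = Transposition.transpose k (K + 1)"
  have \<pi>: "\<pi> permutes {1..K + 1}" "\<pi> (K + 1) = k"
    using k by (auto simp: \<pi>_def intro: permutes_swap_id)
  define data' where "data' \<omega> = (\<lambda>j\<in>{1..K + 1}. Z (\<pi> j) \<omega>)" for \<omega>
  have data' [measurable]: "data' \<in> measurable M tuples"
    unfolding data'_def using measurable_Z permutes_in_image[OF \<pi>(1)] by (intro measurable_restrict) blast
  note measurable_data [measurable]
  define h where "h l D = ennreal (group_mass K {l} D (strange \<A> K \<alpha> D))" for l D
  have h [measurable]: "h l \<in> borel_measurable tuples" if "l \<in> {1..K + 1}" for l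
    unfolding h_def using measurable_strange_mass[OF that] by measurable
  have "h k (data \<omega>) = h (K + 1) (data' \<omega>)" if \<omega>: "\<omega> \<in> space M" for \<omega>
  proof -
    have D: "data \<omega> \<in> space tuples"
      using measurable_space[OF measurable_data \<omega>] .
    have data'_eq: "data' \<omega> = (\<lambda>j\<in>{1..K + 1}. data \<omega> (\<pi> j))"
      using permutes_in_image[OF \<pi>(1)] by (auto simp: data'_def data_def fun_eq_iff)
    have entries: "z \<in> space (obs_space MX Y)" if "z \<in> set (data \<omega> k)" for z
      using Z_in_space[OF k \<omega>] that by (auto simp: data_eq[OF k] group_space_def lists_eq_set)
    have "strange \<A> K \<alpha> (data' \<omega>) (K + 1) z = strange \<A> K \<alpha> (data \<omega>) k z" if "z \<in> set (data \<omega> k)" for z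
      unfolding data'_eq using strange_permute[OF symmetric_\<A> \<pi>(1) D entries[OF that], of "K + 1"]
      by (simp only: \<pi>(2) atLeastAtMost_iff le_refl le_add2 simp_thms)
    moreover have "data' \<omega> (K + 1) = data \<omega> k"
      using \<pi>(2) k by (simp add: data'_def data_def)
    ultimately show ?thesis
      by (simp add: h_def group_mass_def)
  qed
  then have "(\<integral>\<^sup>+\<omega>. h k (data \<omega>) \<partial>M) = (\<integral>\<^sup>+\<omega>. h (K + 1) (data' \<omega>) \<partial>M)"
    by (intro nn_integral_cong)
  also have "\<dots> = (\<integral>\<^sup>+D. h (K + 1) D \<partial>distr M tuples data')"
    using data' h[of "K + 1"] by (simp add: nn_integral_distr)
  also have "distr M tuples data' = distr M tuples data"
    using exchangeable \<pi>(1) unfolding hier_exchangeable_def data_def data'_def by (auto simp: fun_eq_iff)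
  also have "(\<integral>\<^sup>+D. h (K + 1) D \<partial>distr M tuples data) = (\<integral>\<^sup>+\<omega>. h (K + 1) (data \<omega>) \<partial>M)"
    using measurable_data h[of "K + 1"] by (simp add: nn_integral_distr)
  finally show ?thesis
    by (simp add: h_def)
qed

abbreviation strange_entry :: "real \<Rightarrow> nat \<Rightarrow> 'w \<Rightarrow> bool" where
  "strange_entry \<alpha> i \<omega> \<equiv> strange \<A> K \<alpha> (data \<omega>) (K + 1) (entry i (Z (K + 1) \<omega>))"

lemma measurable_strange_entry: "Measurable.pred M (strange_entry \<alpha> i)"
  by (rule measurable_strange[OF measurable_\<A> _ measurable_data measurable_entry_Z]) auto

text \<open>Swapping positions 0 and \<open>i\<close> inside the test group preserves the joint law given its length, and
  it turns the condition on the first entry into the condition on entry \<open>i\<close>.\<close>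
lemma prob_strange_entry_eq:
  assumes i: "i < m"
  shows "prob {\<omega> \<in> space M. length (Z (K + 1) \<omega>) = m \<and> strange_entry \<alpha> i \<omega>} =
    prob {\<omega> \<in> space M. length (Z (K + 1) \<omega>) = m \<and> strange_entry \<alpha> 0 \<omega>}"
proof (cases "\<P>(\<omega> in M. length (Z (K + 1) \<omega>) = m) > 0")
  case False
  have meas: "{\<omega> \<in> space M. length (Z (K + 1) \<omega>) = m} \<in> events"
    using measurable_length_Z[of "K + 1"] by measurable
  \<comment> \<open>If the test group almost surely does not have length \<open>m\<close>, both events are null.\<close>
  have "prob {\<omega> \<in> space M. length (Z (K + 1) \<omega>) = m \<and> P \<omega>} = 0" for P
  proof -
    have "prob {\<omega> \<in> space M. length (Z (K + 1) \<omega>) = m \<and> P \<omega>} \<le>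
        \<P>(\<omega> in M. length (Z (K + 1) \<omega>) = m)"
      by (rule finite_measure_mono[OF _ meas]) auto
    then show ?thesis
      using False by (simp add: order_antisym)
  qed
  then show ?thesis by simp
next
  case True
  define \<sigma> where "\<sigma> = Transposition.transpose 0 i"
  have \<sigma>: "\<sigma> permutes {..<m}"
    using i by (auto simp: \<sigma>_def intro: permutes_swap_id)
  define data' where
    "data' \<omega> = (\<lambda>j\<in>{1..K + 1}. if j = K + 1 then permute_list \<sigma> (Z j \<omega>) else Z j \<omega>)" for \<omega>
  define B where "B = {D \<in> space tuples. strange \<A> K \<alpha> D (K + 1) (entry 0 (D (K + 1)))}"
  have "(\<lambda>D. entry 0 (D (K + 1))) \<in> measurable tuples (obs_space MX Y)"
    using measurable_compose[OF measurable_component_singleton[of "K + 1" "{1..K + 1}"] measurable_entry]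
    by (simp add: group_space_def)
  then have "Measurable.pred tuples (\<lambda>D. strange \<A> K \<alpha> D (K + 1) (entry 0 (D (K + 1))))"
    by (intro measurable_strange[OF measurable_\<A>]) auto
  then have B: "B \<in> sets tuples"
    unfolding B_def by measurable
  have cond: "\<P>(\<omega> in M. data \<omega> \<in> B \<bar> length (Z (K + 1) \<omega>) = m) =
      \<P>(\<omega> in M. data' \<omega> \<in> B \<bar> length (Z (K + 1) \<omega>) = m)"
  proof -
    have "\<forall>k\<in>{1..K + 1}. \<forall>m\<ge>1. \<forall>\<sigma>.
      \<P>(\<omega> in M. length (Z k \<omega>) = m) > 0 \<longrightarrow> \<sigma> permutes {..<m} \<longrightarrow>
      (\<forall>B\<in>sets tuples.
        \<P>(\<omega> in M. (\<lambda>j\<in>{1..K + 1}. Z j \<omega>) \<in> B \<bar> length (Z k \<omega>) = m) =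
        \<P>(\<omega> in M. (\<lambda>j\<in>{1..K + 1}. if j = k then permute_list \<sigma> (Z j \<omega>) else Z j \<omega>) \<in> B
            \<bar> length (Z k \<omega>) = m))"
      using exchangeable unfolding hier_exchangeable_def by (rule conjunct2)
    then have "\<forall>B\<in>sets tuples.
        \<P>(\<omega> in M. (\<lambda>j\<in>{1..K + 1}. Z j \<omega>) \<in> B \<bar> length (Z (K + 1) \<omega>) = m) =
        \<P>(\<omega> in M. (\<lambda>j\<in>{1..K + 1}. if j = K + 1 then permute_list \<sigma> (Z j \<omega>) else Z j \<omega>) \<in> B
            \<bar> length (Z (K + 1) \<omega>) = m)"
      using True \<sigma> i by (elim ballE[of _ _ "K + 1"]) auto
    then show ?thesis
      using B unfolding data_def data'_def by (rule bspec)
  qed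
  have in_B: "data \<omega> \<in> B \<longleftrightarrow> strange_entry \<alpha> 0 \<omega>" if "\<omega> \<in> space M" for \<omega>
    using measurable_space[OF measurable_data that] by (simp add: B_def data_eq)
  have in_B': "data' \<omega> \<in> B \<longleftrightarrow> strange_entry \<alpha> i \<omega>"
    if \<omega>: "\<omega> \<in> space M" and len: "length (Z (K + 1) \<omega>) = m" for \<omega>
  proof -
    have last: "Z (K + 1) \<omega> \<in> space (group_space MX Y)"
      using Z_in_space[of "K + 1"] \<omega> by simp
    have "permute_list \<sigma> (Z (K + 1) \<omega>) \<in> space (group_space MX Y)"
      using permute_list_in_seq_space[OF last[unfolded group_space_def]] \<sigma> len by (simp add: group_space_def)
    then have "data' \<omega> \<in> space tuples"
      using Z_in_space[OF _ \<omega>] by (auto simp: data'_def space_PiM PiE_iff)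
    moreover have "entry 0 (data' \<omega> (K + 1)) = entry i (Z (K + 1) \<omega>)"
      using \<sigma> len i by (simp add: data'_def entry_def permute_list_nth) (simp add: \<sigma>_def)
    moreover have "strange \<A> K \<alpha> (data' \<omega>) (K + 1) z = strange \<A> K \<alpha> (data \<omega>) (K + 1) z" for z
      by (rule strange_cong) (auto simp: data'_def data_def)
    ultimately show ?thesis
      by (simp add: B_def)
  qed
  have "{\<omega> \<in> space M. data \<omega> \<in> B \<and> length (Z (K + 1) \<omega>) = m} =
      {\<omega> \<in> space M. length (Z (K + 1) \<omega>) = m \<and> strange_entry \<alpha> 0 \<omega>}"
    using in_B by blast
  moreover have "{\<omega> \<in> space M. data' \<omega> \<in> B \<and> length (Z (K + 1) \<omega>) = m} =
      {\<omega> \<in> space M. length (Z (K + 1) \<omega>) = m \<and> strange_entry \<alpha> i \<omega>}"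
    using in_B' by blast
  ultimately show ?thesis
    using cond True unfolding cond_prob_def by simp
qed

text \<open>Averaging over the positions of the test group: on the event that its length is \<open>m\<close>, each of
  the \<open>m\<close> entries is strange with the same probability as the first one and has weight
  \<open>1 / ((K + 1) m)\<close>. The length is unbounded, so these slices are added up as a series.\<close>
lemma nn_integral_strange_mass_last:
  "(\<integral>\<^sup>+\<omega>. ennreal (group_mass K {K + 1} (data \<omega>) (strange \<A> K \<alpha> (data \<omega>))) \<partial>M) =
    ennreal (1 / real (K + 1)) * emeasure M {\<omega> \<in> space M. strange_entry \<alpha> 0 \<omega>}"
proof -
  define len where "len \<omega> = length (Z (K + 1) \<omega>)" for \<omega>
  define h where "h \<omega> = ennreal (group_mass K {K + 1} (data \<omega>) (strange \<A> K \<alpha> (data \<omega>)))" for \<omega>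
  define E where "E m i = {\<omega> \<in> space M. len \<omega> = m \<and> strange_entry \<alpha> i \<omega>}" for m i
  define A where "A m = {\<omega> \<in> space M. len \<omega> = m}" for m
  note measurable_strange_entry [measurable] measurable_data [measurable]
  have [measurable]: "len \<in> measurable M (count_space UNIV)"
    using measurable_length_Z[of "K + 1"] by (simp add: len_def[abs_def])
  have E [measurable]: "E m i \<in> events" for m i
    unfolding E_def by measurable
  have A [measurable]: "A m \<in> events" for m
    unfolding A_def by measurable
  have h [measurable]: "h \<in> borel_measurable M"
    unfolding h_def using measurable_compose[OF measurable_data measurable_strange_mass[of "K + 1"]] by simp
  have disj: "disjoint_family A" "disjoint_family (\<lambda>m. E m 0)"
    by (auto simp: disjoint_family_on_def A_def E_def)
  have slice: "(\<integral>\<^sup>+\<omega>. h \<omega> * indicator (A m) \<omega> \<partial>M) = ennreal (1 / real (K + 1)) * emeasure M (E m 0)" for m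
  proof (cases "m = 0")
    case True
    then have "A m = {}" "E m 0 = {}"
      using Z_nonempty[of "K + 1"] by (auto simp: A_def E_def len_def)
    then show ?thesis by simp
  next
    case False
    have "h \<omega> * indicator (A m) \<omega> =
        (\<Sum>i<m. ennreal (1 / (real (K + 1) * real m)) * indicator (E m i) \<omega>)" if "\<omega> \<in> space M" for \<omega>
    proof (cases "\<omega> \<in> A m")
      case True
      then have m: "length (Z (K + 1) \<omega>) = m"
        by (simp add: A_def len_def)
      have "h \<omega> = ennreal (\<Sum>i<m. 1 / (real (K + 1) * real m) * of_bool (strange_entry \<alpha> i \<omega>))"
        unfolding h_def group_mass_def using m by (simp add: data_eq entry_def del: of_nat_Suc of_nat_add cong: sum.cong_simp)
      also have "\<dots> = (\<Sum>i<m. ennreal (1 / (real (K + 1) * real m) * of_bool (strange_entry \<alpha> i \<omega>)))"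
        by (rule sum_ennreal[symmetric]) simp
      also have "\<dots> = (\<Sum>i<m. ennreal (1 / (real (K + 1) * real m)) * indicator (E m i) \<omega>)"
        using that m by (intro sum.cong refl) (auto simp: E_def len_def indicator_def)
      finally show ?thesis
        using True by simp
    qed (auto simp: E_def A_def)
    then have "(\<integral>\<^sup>+\<omega>. h \<omega> * indicator (A m) \<omega> \<partial>M) =
        (\<integral>\<^sup>+\<omega>. (\<Sum>i<m. ennreal (1 / (real (K + 1) * real m)) * indicator (E m i) \<omega>) \<partial>M)"
      by (intro nn_integral_cong)
    also have "\<dots> = (\<Sum>i<m. ennreal (1 / (real (K + 1) * real m)) * emeasure M (E m i))"
      by (subst nn_integral_sum) (simp_all add: nn_integral_cmult_indicator)
    also have "\<dots> = (\<Sum>i<m. ennreal (1 / (real (K + 1) * real m)) * emeasure M (E m 0))"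
    proof (intro sum.cong refl)
      fix i assume "i \<in> {..<m}"
      then have "prob (E m i) = prob (E m 0)"
        using prob_strange_entry_eq[of i m \<alpha>] by (simp only: E_def len_def lessThan_iff)
      then show "ennreal (1 / (real (K + 1) * real m)) * emeasure M (E m i) =
          ennreal (1 / (real (K + 1) * real m)) * emeasure M (E m 0)"
        by (simp only: emeasure_eq_measure)
    qed
    also have "\<dots> = ennreal (1 / real (K + 1)) * emeasure M (E m 0)"
      using False
      by (simp add: emeasure_eq_measure ennreal_of_nat_eq_real_of_nat flip: ennreal_mult')
    finally show ?thesis .
  qed
  have "(\<integral>\<^sup>+\<omega>. h \<omega> \<partial>M) = (\<integral>\<^sup>+\<omega>. (\<Sum>m. h \<omega> * indicator (A m) \<omega>) \<partial>M)"
  proof (rule nn_integral_cong)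
    fix \<omega> assume "\<omega> \<in> space M"
    then have "\<omega> \<in> A (len \<omega>)"
      by (simp add: A_def)
    from suminf_cmult_indicator[OF disj(1) this, of "\<lambda>_. h \<omega>"]
    show "h \<omega> = (\<Sum>m. h \<omega> * indicator (A m) \<omega>)" by simp
  qed
  also have "\<dots> = (\<Sum>m. \<integral>\<^sup>+\<omega>. h \<omega> * indicator (A m) \<omega> \<partial>M)"
    by (rule nn_integral_suminf) measurable
  also have "\<dots> = ennreal (1 / real (K + 1)) * (\<Sum>m. emeasure M (E m 0))"
    by (simp add: slice)
  also have "(\<Sum>m. emeasure M (E m 0)) = emeasure M (\<Union>m. E m 0)"
    using disj(2) by (intro suminf_emeasure) auto
  also have "(\<Union>m. E m 0) = {\<omega> \<in> space M. strange_entry \<alpha> 0 \<omega>}"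
    by (auto simp: E_def)
  finally show ?thesis
    by (simp add: h_def)
qed

text \<open>The expected total weight of the strange entries is the sum of \<open>K + 1\<close> equal shares, each
  being \<open>1 / (K + 1)\<close> times the probability that the test point is strange; by the tournament
  bound the total weight never exceeds \<open>2 \<alpha>\<close>.\<close>
lemma prob_strange_test_le:
  assumes \<alpha>: "0 \<le> \<alpha>"
  shows "prob {\<omega> \<in> space M. strange_entry \<alpha> 0 \<omega>} \<le> 2 * \<alpha>"
proof -
  define h where "h k \<omega> = group_mass K {k} (data \<omega>) (strange \<A> K \<alpha> (data \<omega>))" for k \<omega>
  have h: "(\<lambda>\<omega>. ennreal (h k \<omega>)) \<in> borel_measurable M" if "k \<in> {1..K + 1}" for k
    unfolding h_def using measurable_compose[OF measurable_data measurable_strange_mass[OF that]] by simp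
  have "(\<Sum>k\<in>{1..K + 1}. ennreal (1 / real (K + 1))) = 1"
    by (subst sum_ennreal) (auto simp del: sum_ennreal)
  then have "emeasure M {\<omega> \<in> space M. strange_entry \<alpha> 0 \<omega>} =
      (\<Sum>k\<in>{1..K + 1}. ennreal (1 / real (K + 1)) * emeasure M {\<omega> \<in> space M. strange_entry \<alpha> 0 \<omega>})"
    by (simp only: sum_distrib_right[symmetric] mult_1)
  also have "\<dots> = (\<Sum>k\<in>{1..K + 1}. \<integral>\<^sup>+\<omega>. ennreal (h k \<omega>) \<partial>M)"
    unfolding h_def using expected_strange_mass_eq nn_integral_strange_mass_last
    by (intro sum.cong refl) (simp only:)
  also have "\<dots> = (\<integral>\<^sup>+\<omega>. (\<Sum>k\<in>{1..K + 1}. ennreal (h k \<omega>)) \<partial>M)"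
    using h by (rule nn_integral_sum[symmetric])
  also have "\<dots> = (\<integral>\<^sup>+\<omega>. ennreal (group_mass K {1..K + 1} (data \<omega>) (strange \<A> K \<alpha> (data \<omega>))) \<partial>M)"
    by (intro nn_integral_cong, subst sum_ennreal) (simp_all add: h_def group_mass_nonneg, simp add: group_mass_def)
  also have "\<dots> \<le> (\<integral>\<^sup>+\<omega>. ennreal (2 * \<alpha>) \<partial>M)"
  proof (intro nn_integral_mono ennreal_leI group_mass_strange_le[OF \<alpha>])
    fix \<omega> k assume "\<omega> \<in> space M" "k \<in> {1..K + 1}"
    then show "data \<omega> k \<noteq> []"
      using Z_nonempty[of k \<omega>] by (simp add: data_eq)
  qed
  finally show ?thesis
    using \<alpha> by (simp add: emeasure_eq_measure prob_space)
qed

text \<open>The algorithm and the product space see the groups as a tuple restricted to \<open>{1..K + 1}\<close>,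
  whereas the prediction set is formed from the unrestricted family \<open>\<lambda>k. Z k \<omega>\<close>; the two agree
  on every group that enters.\<close>
lemma coverage_iff:
  assumes \<alpha>: "\<alpha> < 1" and \<omega>: "\<omega> \<in> space M"
  shows "y \<in> hier_jackknife_plus \<A> K \<alpha> (\<lambda>k. Z k \<omega>) x \<longleftrightarrow> y \<in> hier_jackknife_plus \<A> K \<alpha> (data \<omega>) x"
proof -
  have model: "logo2_model \<A> K (\<lambda>k. Z k \<omega>) k (K + 1) = logo2_model \<A> K (data \<omega>) k (K + 1)"
    if "k \<in> {1..K}" for k
    using that by (intro logo2_model_cong) (auto simp: data_eq)
  have "group_mass K {1..K} (\<lambda>k. Z k \<omega>)
      (\<lambda>k z. y < logo2_model \<A> K (\<lambda>k. Z k \<omega>) k (K + 1) x - logo2_residual \<A> K (\<lambda>k. Z k \<omega>) k (K + 1) z) =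
    group_mass K {1..K} (data \<omega>)
      (\<lambda>k z. y < logo2_model \<A> K (data \<omega>) k (K + 1) x - logo2_residual \<A> K (data \<omega>) k (K + 1) z)"
    using model by (intro group_mass_cong) (auto simp: data_eq logo2_residual_def)
  moreover have "group_mass K {1..K} (\<lambda>k. Z k \<omega>)
      (\<lambda>k z. logo2_model \<A> K (\<lambda>k. Z k \<omega>) k (K + 1) x + logo2_residual \<A> K (\<lambda>k. Z k \<omega>) k (K + 1) z < y) =
    group_mass K {1..K} (data \<omega>)
      (\<lambda>k z. logo2_model \<A> K (data \<omega>) k (K + 1) x + logo2_residual \<A> K (data \<omega>) k (K + 1) z < y)"
    using model by (intro group_mass_cong) (auto simp: data_eq logo2_residual_def)
  ultimately show ?thesis
    using \<omega> \<alpha> Z_nonempty by (simp add: mem_hier_jackknife_plus_iff data_eq)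
qed

lemma measurable_coverage:
  assumes \<alpha>: "\<alpha> < 1"
  shows "{\<omega> \<in> space M. snd (hd (Z (K + 1) \<omega>)) \<in>
    hier_jackknife_plus \<A> K \<alpha> (\<lambda>k. Z k \<omega>) (fst (hd (Z (K + 1) \<omega>)))} \<in> events"
proof -
  define x where "x \<omega> = fst (entry 0 (Z (K + 1) \<omega>))" for \<omega>
  define y where "y \<omega> = snd (entry 0 (Z (K + 1) \<omega>))" for \<omega>
  define lo where "lo k \<omega> z =
    logo2_model \<A> K (data \<omega>) k (K + 1) (x \<omega>) - logo2_residual \<A> K (data \<omega>) k (K + 1) z" for k \<omega> z
  define hi where "hi k \<omega> z =
    logo2_model \<A> K (data \<omega>) k (K + 1) (x \<omega>) + logo2_residual \<A> K (data \<omega>) k (K + 1) z" for k \<omega> z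
  have test: "(\<lambda>\<omega>. entry 0 (Z (K + 1) \<omega>)) \<in> measurable M (obs_space MX Y)"
    by (rule measurable_entry_Z) simp
  have x [measurable]: "x \<in> measurable M MX"
    using test by (auto simp: x_def[abs_def] obs_space_def)
  have "y \<in> measurable M (restrict_space borel Y)"
    using test by (auto simp: y_def[abs_def] obs_space_def)
  then have y [measurable]: "y \<in> borel_measurable M"
    by (simp add: measurable_restrict_space2_iff)
  note measurable_data [measurable]
  have lo_hi: "(\<lambda>p. lo k (fst p) (snd p)) \<in> borel_measurable (M \<Otimes>\<^sub>M obs_space MX Y)"
      "(\<lambda>p. hi k (fst p) (snd p)) \<in> borel_measurable (M \<Otimes>\<^sub>M obs_space MX Y)" if "k \<in> {1..K}" for k
  proof -
    have k: "k \<in> {1..K + 1}" "K + 1 \<in> {1..K + 1}" "k \<noteq> K + 1"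
      using that by auto
    have [measurable]: "(\<lambda>p. logo2_model \<A> K (data (fst p)) k (K + 1) (x (fst p))) \<in>
        borel_measurable (M \<Otimes>\<^sub>M obs_space MX Y)"
      by (rule measurable_logo2_model[OF measurable_\<A> k]) measurable
    have [measurable]: "(\<lambda>p. logo2_residual \<A> K (data (fst p)) k (K + 1) (snd p)) \<in>
        borel_measurable (M \<Otimes>\<^sub>M obs_space MX Y)"
      by (rule measurable_logo2_residual[OF measurable_\<A> k]) measurable
    show "(\<lambda>p. lo k (fst p) (snd p)) \<in> borel_measurable (M \<Otimes>\<^sub>M obs_space MX Y)"
      "(\<lambda>p. hi k (fst p) (snd p)) \<in> borel_measurable (M \<Otimes>\<^sub>M obs_space MX Y)"
      unfolding lo_def hi_def by measurable
  qed
  have "(\<lambda>\<omega>. group_mass K {1..K} (data \<omega>) (\<lambda>k z. y \<omega> < lo k \<omega> z)) \<in> borel_measurable M"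
  proof (rule measurable_group_mass[OF _ measurable_data[unfolded group_space_def]])
    fix k assume "k \<in> {1..K}"
    note lo_hi[OF this, measurable]
    show "Measurable.pred (M \<Otimes>\<^sub>M obs_space MX Y) (\<lambda>p. y (fst p) < lo k (fst p) (snd p))"
      by measurable
  qed auto
  moreover have "(\<lambda>\<omega>. group_mass K {1..K} (data \<omega>) (\<lambda>k z. hi k \<omega> z < y \<omega>)) \<in> borel_measurable M"
  proof (rule measurable_group_mass[OF _ measurable_data[unfolded group_space_def]])
    fix k assume "k \<in> {1..K}"
    note lo_hi[OF this, measurable]
    show "Measurable.pred (M \<Otimes>\<^sub>M obs_space MX Y) (\<lambda>p. hi k (fst p) (snd p) < y (fst p))"
      by measurable
  qed auto
  ultimately have "{\<omega> \<in> space M. \<not> 1 - \<alpha> \<le> group_mass K {1..K} (data \<omega>) (\<lambda>k z. y \<omega> < lo k \<omega> z) \<and>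
      \<not> 1 - \<alpha> \<le> group_mass K {1..K} (data \<omega>) (\<lambda>k z. hi k \<omega> z < y \<omega>)} \<in> events"
    by measurable
  also have "{\<omega> \<in> space M. \<not> 1 - \<alpha> \<le> group_mass K {1..K} (data \<omega>) (\<lambda>k z. y \<omega> < lo k \<omega> z) \<and>
      \<not> 1 - \<alpha> \<le> group_mass K {1..K} (data \<omega>) (\<lambda>k z. hi k \<omega> z < y \<omega>)} =
    {\<omega> \<in> space M. snd (hd (Z (K + 1) \<omega>)) \<in>
      hier_jackknife_plus \<A> K \<alpha> (\<lambda>k. Z k \<omega>) (fst (hd (Z (K + 1) \<omega>)))}"
  proof (intro Collect_cong conj_cong refl)
    fix \<omega> assume \<omega>: "\<omega> \<in> space M"
    have "\<forall>k\<in>{1..K}. data \<omega> k \<noteq> []"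
      using Z_nonempty[OF _ \<omega>] by (simp add: data_eq)
    note iff = mem_hier_jackknife_plus_iff[of \<alpha> K "data \<omega>", OF \<alpha> this]
    have "hd (Z (K + 1) \<omega>) = entry 0 (Z (K + 1) \<omega>)"
      using Z_nonempty[of "K + 1", OF _ \<omega>] by (simp add: entry_def hd_conv_nth)
    then show "(\<not> 1 - \<alpha> \<le> group_mass K {1..K} (data \<omega>) (\<lambda>k z. y \<omega> < lo k \<omega> z) \<and>
        \<not> 1 - \<alpha> \<le> group_mass K {1..K} (data \<omega>) (\<lambda>k z. hi k \<omega> z < y \<omega>)) =
      (snd (hd (Z (K + 1) \<omega>)) \<in> hier_jackknife_plus \<A> K \<alpha> (\<lambda>k. Z k \<omega>) (fst (hd (Z (K + 1) \<omega>))))"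
      unfolding coverage_iff[OF \<alpha> \<omega>] iff by (simp add: x_def y_def lo_def hi_def)
  qed
  finally show ?thesis .
qed

lemma coverage_ge:
  assumes \<alpha>: "0 \<le> \<alpha>" "\<alpha> < 1"
  shows "\<P>(\<omega> in M. snd (hd (Z (K + 1) \<omega>)) \<in>
    hier_jackknife_plus \<A> K \<alpha> (\<lambda>k. Z k \<omega>) (fst (hd (Z (K + 1) \<omega>)))) \<ge> 1 - 2 * \<alpha>"
    (is "prob ?C \<ge> _")
proof -
  have "space M - ?C \<subseteq> {\<omega> \<in> space M. strange_entry \<alpha> 0 \<omega>}"
  proof safe
    fix \<omega> assume \<omega>: "\<omega> \<in> space M"
      and "snd (hd (Z (K + 1) \<omega>)) \<notin> hier_jackknife_plus \<A> K \<alpha> (\<lambda>k. Z k \<omega>) (fst (hd (Z (K + 1) \<omega>)))"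
    then have miss: "snd (hd (Z (K + 1) \<omega>)) \<notin> hier_jackknife_plus \<A> K \<alpha> (data \<omega>) (fst (hd (Z (K + 1) \<omega>)))"
      using coverage_iff[OF \<alpha>(2)] by blast
    have "\<forall>k\<in>{1..K}. data \<omega> k \<noteq> []"
      using Z_nonempty[OF _ \<omega>] by (simp add: data_eq)
    from strange_if_not_covered[OF \<alpha>(2) this miss]
    show "strange_entry \<alpha> 0 \<omega>"
      using Z_nonempty[of "K + 1", OF _ \<omega>] by (simp add: entry_def hd_conv_nth)
  qed
  moreover have "{\<omega> \<in> space M. strange_entry \<alpha> 0 \<omega>} \<in> events"
    using measurable_strange_entry by measurable
  ultimately have "prob (space M - ?C) \<le> 2 * \<alpha>"
    using finite_measure_mono prob_strange_test_le[OF \<alpha>(1)] order_trans by blast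
  then show ?thesis
    using prob_compl[OF measurable_coverage[OF \<alpha>(2)]] by linarith
qed

end

theorem theorem5:
  fixes M :: "'w measure" and MX :: "'x measure" and Y :: "real set"
    and K :: nat and \<alpha> :: real
    and Z :: "nat \<Rightarrow> 'w \<Rightarrow> ('x \<times> real) list"
    and \<A> :: "(nat \<Rightarrow> ('x \<times> real) list) \<Rightarrow> 'x \<Rightarrow> real"
  assumes "prob_space M"
    and "0 < \<alpha>" and "\<alpha> < 1" and "K \<ge> 1"
    and "\<And>k. k \<in> {1..K + 1} \<Longrightarrow> Z k \<in> measurable M (group_space MX Y)"
    and "hier_exchangeable M (group_space MX Y) (K + 1) Z"
    and "measurable_algorithm MX (group_space MX Y) (K - 1) \<A>"
    and "hier_symmetric MX (group_space MX Y) (K - 1) \<A>"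
  shows "\<P>(\<omega> in M. snd (hd (Z (K + 1) \<omega>)) \<in>
           hier_jackknife_plus \<A> K \<alpha> (\<lambda>k. Z k \<omega>) (fst (hd (Z (K + 1) \<omega>)))) \<ge> 1 - 2 * \<alpha>"
proof -
  interpret prob_space M by fact
  interpret hierarchical_sample M MX Y K Z \<A>
    using assms(5-8) by unfold_locales
  show ?thesis
    using assms(2,3) by (intro coverage_ge) auto
qed

end
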